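(* Let $X$ be a real Banach space such that $X^*$ has the Radon–Nikodym property (in the sense below), and let $g:X^*\to(-\infty,+\infty]$ be a proper convex weak$^*$-lower semicontinuous function which is $w^*$-epi-pointed, i.e. $\operatorname{int}(\operatorname{dom}(g^*|_X))\ne\emptyset$. Let $x_0^*\in D(\partial g\cap X)$. Then for every $x^*\in X^*$, $$g(x^* )-g(x_0^* )=\sup\Big\{\sum_{i=0}^{n-1}\langle x_i,x_{i+1}^*-x_i^*\rangle+\langle x_n,x^*-x_n^*\rangle\Big\},$$ where the supremum is taken over all integers $n\ge0$, all $x_1^*,\dots,x_n^*\in w^*\text{-}\mathrm{exp}\,g$ and all $x_i\in\partial g(x_i^* )\cap X$ for $i=0,1,\dots,n$.
   Context: $X$ is identified with its canonical image in $X^{**}$; for $x^*\in\operatorname{dom} g=\{g<+\infty\}$, $\partial g(x^* )\cap X=\{x\in X:\langle y^*-x^*,x\rangle\le g(y^* )-g(x^* )\ \forall y^*\in X^*\}$, and $D(\partial g\cap X)=\{x^*:\partial g(x^* )\cap X\ne\emptyset\}$. $g^*|_X(x)=\sup_{x^*\in X^*}(\langle x^*,x\rangle-g(x^* ))$, interior in the norm topology of $X$. For a nonempty closed convex $C\subset X^*\times\mathbb{R}$ (dual of $X\times\mathbb{R}$) with $\sigma_C(u)=\sup_{c\in C}\langle c,u\rangle$, a point $c_0\in C$ is $w^*$-strongly exposed by $u\in X\times\mathbb{R}$ if for every sequence $(c_n)\subset C$, $\langle c_n,u\rangle\to\sigma_C(u)$ implies $c_n\to c_0$ in norm. $x^*\in\operatorname{dom}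 g$ belongs to $w^*\text{-}\mathrm{exp}\,g$ (is a $w^*$-strongly exposed point of $g$) if $(x^*,g(x^* ))$ is $w^*$-strongly exposed (by some element of $X\times\mathbb{R}$) in $\operatorname{epi} g=\{(y^*,r)\in X^*\times\mathbb{R}:r\ge g(y^* )\}$. $X^*$ has the Radon–Nikodym property if every nonempty weak$^*$-compact convex $K\subset X^*$ equals the weak$^*$-closed convex hull of its $w^*$-strongly exposed points (points $u^*\in K$ for which some $u\in X$ satisfies: $(u_n^* )\subset K$, $\langle u_n^*,u\rangle\to\sup_K u$ implies $u_n^*\to u^*$ in norm). *)

theory Defs
  imports "HOL-Analysis.Analysis"
begin

definition wstar_topology :: "('a::real_normed_vector \<Rightarrow>\<^sub>L real) topology" where
  "wstar_topology = topology_generated_by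
     {{f. blinfun_apply f x \<in> U} | x U. open (U::real set)}"

definition wstar_lsc :: "(('a::real_normed_vector \<Rightarrow>\<^sub>L real) \<Rightarrow> ereal) \<Rightarrow> bool" where
  "wstar_lsc g \<longleftrightarrow> (\<forall>r::ereal. closedin wstar_topology {f. g f \<le> r})"

definition epi :: "(('a::real_normed_vector \<Rightarrow>\<^sub>L real) \<Rightarrow> ereal) \<Rightarrow> (('a \<Rightarrow>\<^sub>L real) \<times> real) set" where
  "epi g = {(f, r). g f \<le> ereal r}"

definition proper_fun :: "('b \<Rightarrow> ereal) \<Rightarrow> bool" where
  "proper_fun g \<longleftrightarrow> (\<forall>x. g x \<noteq> -\<infinity>) \<and> (\<exists>x. g x \<noteq> \<infinity>)"

definition convex_fun :: "(('a::real_normed_vector \<Rightarrow>\<^sub>L real) \<Rightarrow> ereal) \<Rightarrow> bool" where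
  "convex_fun g \<longleftrightarrow> convex (epi g)"

definition conj_X :: "(('a::real_normed_vector \<Rightarrow>\<^sub>L real) \<Rightarrow> ereal) \<Rightarrow> 'a \<Rightarrow> ereal" where
  "conj_X g x = (SUP f. ereal (blinfun_apply f x) - g f)"

definition wstar_epi_pointed :: "(('a::real_normed_vector \<Rightarrow>\<^sub>L real) \<Rightarrow> ereal) \<Rightarrow> bool" where
  "wstar_epi_pointed g \<longleftrightarrow> interior {x. conj_X g x < \<infinity>} \<noteq> {}"

definition subdiff_X :: "(('a::real_normed_vector \<Rightarrow>\<^sub>L real) \<Rightarrow> ereal) \<Rightarrow> ('a \<Rightarrow>\<^sub>L real) \<Rightarrow> 'a set" where
  "subdiff_X g f = {x. g f < \<infinity> \<and>
     (\<forall>h. ereal (blinfun_apply h x - blinfun_apply f x) \<le> g h - g f)}"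

definition dom_subdiff_X :: "(('a::real_normed_vector \<Rightarrow>\<^sub>L real) \<Rightarrow> ereal) \<Rightarrow> ('a \<Rightarrow>\<^sub>L real) set" where
  "dom_subdiff_X g = {f. subdiff_X g f \<noteq> {}}"

definition pair :: "(('a::real_normed_vector \<Rightarrow>\<^sub>L real) \<times> real) \<Rightarrow> ('a \<times> real) \<Rightarrow> real" where
  "pair c u = blinfun_apply (fst c) (fst u) + snd c * snd u"

definition wstar_strongly_exposed_by ::
  "(('a::real_normed_vector \<Rightarrow>\<^sub>L real) \<times> real) set \<Rightarrow> (('a \<Rightarrow>\<^sub>L real) \<times> real) \<Rightarrow> ('a \<times> real) \<Rightarrow> bool" where
  "wstar_strongly_exposed_by C c0 u \<longleftrightarrow> c0 \<in> C \<and>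
     (\<forall>c::nat \<Rightarrow> ('a \<Rightarrow>\<^sub>L real) \<times> real. (\<forall>n. c n \<in> C) \<longrightarrow>
        ((\<lambda>n. ereal (pair (c n) u)) \<longlonglongrightarrow> (SUP d\<in>C. ereal (pair d u))) \<longrightarrow>
        c \<longlonglongrightarrow> c0)"

definition wstar_exp :: "(('a::real_normed_vector \<Rightarrow>\<^sub>L real) \<Rightarrow> ereal) \<Rightarrow> ('a \<Rightarrow>\<^sub>L real) set" where
  "wstar_exp g = {f. g f < \<infinity> \<and>
     (\<exists>u. wstar_strongly_exposed_by (epi g) (f, real_of_ereal (g f)) u)}"

definition wstar_sexp_points :: "('a::real_normed_vector \<Rightarrow>\<^sub>L real) set \<Rightarrow> ('a \<Rightarrow>\<^sub>L real) set" where
  "wstar_sexp_points K = {p \<in> K. \<exists>u::'a.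
     \<forall>q::nat \<Rightarrow> ('a \<Rightarrow>\<^sub>L real). (\<forall>n. q n \<in> K) \<longrightarrow>
        ((\<lambda>n. ereal (blinfun_apply (q n) u)) \<longlonglongrightarrow> (SUP k\<in>K. ereal (blinfun_apply k u))) \<longrightarrow>
        q \<longlonglongrightarrow> p}"

definition wstar_closed_convex_hull :: "('a::real_normed_vector \<Rightarrow>\<^sub>L real) set \<Rightarrow> ('a \<Rightarrow>\<^sub>L real) set" where
  "wstar_closed_convex_hull S = \<Inter>{C. closedin wstar_topology C \<and> convex C \<and> S \<subseteq> C}"

definition dual_RNP :: "'a::real_normed_vector itself \<Rightarrow> bool" where
  "dual_RNP _ \<longleftrightarrow> (\<forall>K::('a \<Rightarrow>\<^sub>L real) set. K \<noteq> {} \<and> compactin wstar_topology K \<and> convex K \<longrightarrow>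
      K = wstar_closed_convex_hull (wstar_sexp_points K))"

end

theory Submission
  imports Defs
begin

text \<open>Let \<open>f = g\<^sup>*|\<^sub>X\<close>, so that \<open>g\<close> is the conjugate of \<open>f\<close>. The Radon--Nikodym property yields
  small \<open>w\<^sup>*\<close>-slices of the set of subgradients of \<open>f\<close> near any interior point of its domain; by
  monotonicity of the subdifferential and Baire's theorem, \<open>f\<close> is Frechet differentiable on a dense
  subset \<open>G\<close> of the interior, and its derivatives there are \<open>w\<^sup>*\<close>-strongly exposed points of \<open>g\<close>.

  For a lower bound of \<open>g(x\<^sup>*)\<close> choose \<open>u\<close> in the interior with \<open>\<langle>x\<^sup>*, u\<rangle> - f(u)\<close> close to
  \<open>g(x\<^sup>*)\<close> and walk from \<open>x\<^sub>0\<close> to \<open>u\<close> in \<open>N\<close> equal steps, each intermediate point being moved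
  slightly into \<open>G\<close>. The chain along these points misses \<open>\<langle>x\<^sup>*, u\<rangle> - f(u) - g(x\<^sub>0\<^sup>*)\<close> by a sum
  of Bregman distances, which is at most a telescoping sum of second differences of \<open>f\<close> along the
  segment and hence tends to \<open>0\<close> as \<open>N\<close> grows.\<close>

section \<open>The weak* topology\<close>

lemma topspace_wstar: "topspace (wstar_topology :: ('a::real_normed_vector \<Rightarrow>\<^sub>L real) topology) = UNIV"
proof -
  have "UNIV = {f::'a \<Rightarrow>\<^sub>L real. blinfun_apply f 0 \<in> UNIV}" by simp
  then have "(UNIV :: ('a \<Rightarrow>\<^sub>L real) set) \<in> {{f. blinfun_apply f x \<in> U} | x U. open (U::real set)}"
    by blast
  then show ?thesis
    unfolding wstar_topology_def topology_generated_by_topspace by blast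
qed

lemma openin_wstar_eval:
  assumes "open U"
  shows "openin wstar_topology {q :: 'a::real_normed_vector \<Rightarrow>\<^sub>L real. blinfun_apply q x \<in> U}"
  unfolding wstar_topology_def
  by (rule topology_generated_by_Basis) (use assms in blast)

lemma closedin_wstar_eval:
  assumes "closed U"
  shows "closedin wstar_topology {q :: 'a::real_normed_vector \<Rightarrow>\<^sub>L real. blinfun_apply q x \<in> U}"
proof -
  have "- {q :: 'a \<Rightarrow>\<^sub>L real. blinfun_apply q x \<in> U} = {q. blinfun_apply q x \<in> - U}" by auto
  then show ?thesis
    using openin_wstar_eval[of "- U" x] assms
    by (simp add: closedin_def topspace_wstar Compl_eq_Diff_UNIV[symmetric] open_Compl)
qed

text \<open>By induction over the generation of the topology; an intersection is handled by uniting
  the finite sets and taking the smaller radius.\<close>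

lemma openin_wstar_nbhd:
  fixes S :: "('a::real_normed_vector \<Rightarrow>\<^sub>L real) set"
  assumes "openin wstar_topology S" "p \<in> S"
  shows "\<exists>Y d. finite Y \<and> d > 0 \<and> {q. \<forall>x\<in>Y. \<bar>blinfun_apply q x - blinfun_apply p x\<bar> < d} \<subseteq> S"
proof -
  have "generate_topology_on {{f. blinfun_apply f x \<in> U} | x U. open (U::real set)} S"
    using assms(1) unfolding wstar_topology_def openin_topology_generated_by_iff .
  then show ?thesis
    using assms(2)
  proof (induction rule: generate_topology_on.induct)
    case Empty
    then show ?case by simp
  next
    case (Int a b)
    obtain Y d where "finite Y" "d > 0"
      and a: "{q. \<forall>x\<in>Y. \<bar>blinfun_apply q x - blinfun_apply p x\<bar> < d} \<subseteq> a"
      using Int by blast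
    obtain Z e where "finite Z" "e > 0"
      and b: "{q. \<forall>x\<in>Z. \<bar>blinfun_apply q x - blinfun_apply p x\<bar> < e} \<subseteq> b"
      using Int by blast
    have "{q. \<forall>x\<in>Y \<union> Z. \<bar>blinfun_apply q x - blinfun_apply p x\<bar> < min d e} \<subseteq> a \<inter> b"
      using a b by auto
    with \<open>finite Y\<close> \<open>finite Z\<close> \<open>d > 0\<close> \<open>e > 0\<close> show ?case
      by (intro exI[of _ "Y \<union> Z"] exI[of _ "min d e"]) auto
  next
    case (UN K)
    then show ?case by (meson Union_iff Union_upper subset_trans)
  next
    case (Basis s)
    then obtain x U where s: "s = {f. blinfun_apply f x \<in> U}" "open U" by blast
    with Basis obtain d where "d > 0" "\<And>y. dist y (blinfun_apply p x) < d \<Longrightarrow> y \<in> U"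
      by (auto simp: open_dist)
    then show ?case
      by (intro exI[of _ "{x}"] exI[of _ d]) (auto simp: s dist_real_def)
  qed
qed

text \<open>This reduces separation from a weak* closed set to finitely many real coordinates, where
  a nearest-point argument is available.\<close>

lemma closedin_wstar_separated:
  fixes C :: "('a::real_normed_vector \<Rightarrow>\<^sub>L real) set"
  assumes "closedin wstar_topology C" "p \<notin> C"
  obtains Y d where "finite Y" "d > 0"
    "\<And>q. q \<in> C \<Longrightarrow> \<exists>x\<in>Y. \<bar>blinfun_apply q x - blinfun_apply p x\<bar> \<ge> d"
proof -
  have "openin wstar_topology (- C)"
    using assms(1) by (simp add: closedin_def topspace_wstar Compl_eq_Diff_UNIV)
  from openin_wstar_nbhd[OF this, of p] assms(2)
  obtain Y d where "finite Y" "d > 0"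
    and sub: "{q. \<forall>x\<in>Y. \<bar>blinfun_apply q x - blinfun_apply p x\<bar> < d} \<subseteq> - C" by auto
  moreover have "\<exists>x\<in>Y. \<bar>blinfun_apply q x - blinfun_apply p x\<bar> \<ge> d" if "q \<in> C" for q
    using sub that by (force simp: not_less[symmetric])
  ultimately show ?thesis using that by blast
qed

text \<open>Tychonoff: the ball is the image under \<open>Blinfun\<close> of the linear functions
  inside a product of compact intervals, and linearity is a closed condition in the product
  topology.\<close>

theorem Banach_Alaoglu:
  "compactin wstar_topology (cball (0 :: 'a::real_normed_vector \<Rightarrow>\<^sub>L real) L)"
proof (cases "L \<ge> 0")
  case False
  then show ?thesis by simp
next
  case True
  define P where "P = (product_topology (\<lambda>_::'a. euclideanreal) UNIV)"
  define B where "B = (PiE UNIV (\<lambda>x::'a. {- (L * norm x)..L * norm x}))"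
  define Lin where "Lin = {\<phi> :: 'a \<Rightarrow> real. linear \<phi>}"
  have proj: "continuous_map P euclideanreal (\<lambda>\<phi>. \<phi> x)" for x
    unfolding P_def by (rule continuous_map_product_projection) simp
  have "compactin P B"
    unfolding P_def B_def compactin_PiE by (simp add: compact_Icc)
  have top: "topspace P = UNIV" by (simp add: P_def)
  have cl1: "closedin P {\<phi>. \<phi> (x + y) = \<phi> x + \<phi> y}" for x y :: 'a
    using closedin_continuous_maps_eq[of euclideanreal P "\<lambda>\<phi>. \<phi> (x + y)" "\<lambda>\<phi>. \<phi> x + \<phi> y"]
    by (simp add: proj top continuous_map_add)
  have cl2: "closedin P {\<phi>. \<phi> (c *\<^sub>R x) = c * \<phi> x}" for c :: real and x :: 'a
    using closedin_continuous_maps_eq[of euclideanreal P "\<lambda>\<phi>. \<phi> (c *\<^sub>R x)" "\<lambda>\<phi>. c * \<phi> x"]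
    by (simp add: proj top continuous_map_real_mult_left)
  have "Lin = (\<Inter>x y. {\<phi>. \<phi> (x + y) = \<phi> x + \<phi> y}) \<inter> (\<Inter>c x. {\<phi>. \<phi> (c *\<^sub>R x) = c * \<phi> x})"
    unfolding Lin_def by (auto simp: linear_iff)
  moreover have "closedin P \<dots>"
    by (intro closedin_Int closedin_INT cl1 cl2) auto
  ultimately have "closedin P Lin" by simp
  with \<open>compactin P B\<close> have cpt: "compactin P (B \<inter> Lin)"
    using closed_Int_compactin[of P Lin B] by (simp add: Int_commute)
  have bl: "bounded_linear \<phi>" if "\<phi> \<in> B \<inter> Lin" for \<phi>
  proof -
    from that have "linear \<phi>" by (simp add: Lin_def)
    moreover have "\<bar>\<phi> x\<bar> \<le> norm x * L" for x
      using that by (auto simp: B_def abs_le_iff mult.commute dest!: IntD1 PiE_mem[of _ _ _ x])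
    ultimately show ?thesis
      by (intro bounded_linear.intro bounded_linear_axioms.intro exI[of _ L]) auto
  qed
  have cont: "continuous_map (subtopology P (B \<inter> Lin)) wstar_topology Blinfun"
    unfolding wstar_topology_def
  proof (rule continuous_on_generated_topo)
    fix S assume "S \<in> {{f :: 'a \<Rightarrow>\<^sub>L real. blinfun_apply f x \<in> U} | x U. open (U::real set)}"
    then obtain x U where S: "S = {f. blinfun_apply f x \<in> U}" "open U" by blast
    have "Blinfun -` S \<inter> topspace (subtopology P (B \<inter> Lin))
        = {\<phi> \<in> topspace P. \<phi> x \<in> U} \<inter> (B \<inter> Lin)"
      using bl by (auto simp: S top bounded_linear_Blinfun_apply)
    moreover have "openin P {\<phi> \<in> topspace P. \<phi> x \<in> U}"
      using proj[of x] \<open>open U\<close> by (auto simp: continuous_map)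
    ultimately show "openin (subtopology P (B \<inter> Lin)) (Blinfun -` S \<inter> topspace (subtopology P (B \<inter> Lin)))"
      by (auto simp: openin_subtopology)
  next
    show "Blinfun ` topspace (subtopology P (B \<inter> Lin))
        \<subseteq> \<Union> {{f :: 'a \<Rightarrow>\<^sub>L real. blinfun_apply f x \<in> U} | x U. open (U::real set)}"
      using topspace_wstar unfolding wstar_topology_def topology_generated_by_topspace by blast
  qed
  have "Blinfun ` (B \<inter> Lin) = cball 0 L"
  proof (intro equalityI subsetI)
    fix q assume "q \<in> Blinfun ` (B \<inter> Lin)"
    then obtain \<phi> where \<phi>: "\<phi> \<in> B \<inter> Lin" "q = Blinfun \<phi>" by blast
    have le: "\<bar>\<phi> x\<bar> \<le> L * norm x" for x
      using \<phi> by (auto simp: B_def abs_le_iff dest!: IntD1 PiE_mem[of _ _ _ x])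
    have ap: "blinfun_apply q = \<phi>" using \<phi> bl bounded_linear_Blinfun_apply by blast
    show "q \<in> cball 0 L"
      using True le ap norm_blinfun_bound[of L q] by simp
  next
    fix q :: "'a \<Rightarrow>\<^sub>L real" assume q: "q \<in> cball 0 L"
    then have "\<bar>blinfun_apply q x\<bar> \<le> L * norm x" for x
      using order_trans[OF norm_blinfun[of q x] mult_right_mono[of "norm q" L "norm x"]] by simp
    then have "blinfun_apply q \<in> B \<inter> Lin"
      by (auto simp: B_def Lin_def abs_le_iff blinfun.bounded_linear_right bounded_linear.linear minus_le_iff)
    then show "q \<in> Blinfun ` (B \<inter> Lin)"
      by (metis blinfun_apply_inverse image_eqI)
  qed
  moreover have "compactin (subtopology P (B \<inter> Lin)) (B \<inter> Lin)"
    using cpt by (simp add: compactin_subtopology)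
  ultimately show ?thesis
    using image_compactin[OF _ cont] by metis
qed

section \<open>Weak* closed convex hulls and small slices\<close>

lemma closedin_wstar_cball: "closedin wstar_topology (cball (0 :: 'a::real_normed_vector \<Rightarrow>\<^sub>L real) L)"
proof (cases "L \<ge> 0")
  case True
  have "cball (0 :: 'a \<Rightarrow>\<^sub>L real) L = (\<Inter>x. {q. blinfun_apply q x \<in> {- (L * norm x)..L * norm x}})"
  proof (intro equalityI subsetI)
    fix q :: "'a \<Rightarrow>\<^sub>L real" assume "q \<in> cball 0 L"
    then have "\<bar>blinfun_apply q x\<bar> \<le> L * norm x" for x
      using order_trans[OF norm_blinfun[of q x] mult_right_mono[of "norm q" L "norm x"]] by simp
    then show "q \<in> (\<Inter>x. {q. blinfun_apply q x \<in> {- (L * norm x)..L * norm x}})"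
      by (auto simp: abs_le_iff minus_le_iff)
  next
    fix q :: "'a \<Rightarrow>\<^sub>L real"
    assume "q \<in> (\<Inter>x. {q. blinfun_apply q x \<in> {- (L * norm x)..L * norm x}})"
    then have "\<bar>blinfun_apply q x\<bar> \<le> L * norm x" for x
      by (auto simp: abs_le_iff minus_le_iff)
    then show "q \<in> cball 0 L"
      using norm_blinfun_bound[OF True, of q] by simp
  qed
  moreover have "closedin wstar_topology \<dots>"
    by (intro closedin_INT closedin_wstar_eval) auto
  ultimately show ?thesis by simp
qed simp

lemma closedin_wstar_hull: "closedin wstar_topology (wstar_closed_convex_hull S)"
  unfolding wstar_closed_convex_hull_def
proof (rule closedin_Inter)
  have "UNIV \<in> {C. closedin wstar_topology C \<and> convex C \<and> S \<subseteq> C}"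
    using closedin_topspace[of wstar_topology] by (simp add: topspace_wstar)
  then show "{C. closedin wstar_topology C \<and> convex C \<and> S \<subseteq> C} \<noteq> {}" by blast
qed blast

lemma convex_wstar_hull: "convex (wstar_closed_convex_hull S)"
  unfolding wstar_closed_convex_hull_def by (auto intro: convex_Inter)

lemma subset_wstar_hull: "S \<subseteq> wstar_closed_convex_hull S"
  unfolding wstar_closed_convex_hull_def by blast

lemma wstar_hull_minimal:
  "\<lbrakk>closedin wstar_topology C; convex C; S \<subseteq> C\<rbrakk> \<Longrightarrow> wstar_closed_convex_hull S \<subseteq> C"
  unfolding wstar_closed_convex_hull_def by blast

lemma convex_halfspace_eval: "convex {q :: 'a::real_normed_vector \<Rightarrow>\<^sub>L real. blinfun_apply q x \<le> s}"
proof -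
  have "{q :: 'a \<Rightarrow>\<^sub>L real. blinfun_apply q x \<le> s} = (\<lambda>q. blinfun_apply q x) -` {..s}" by auto
  then show ?thesis
    by (simp add: convex_linear_vimage bounded_linear.linear[OF blinfun.bounded_linear_left])
qed

text \<open>The weak* closed convex hull of \<open>A\<close> is compact, so the Radon-Nikodym
  property gives it a strongly exposed point, around which thin slices are small in norm. Such a
  slice of the hull meets \<open>A\<close>, since otherwise a half-space would contain
  \<open>A\<close> and hence the hull.\<close>

lemma dual_RNP_small_slice:
  fixes A :: "('a::real_normed_vector \<Rightarrow>\<^sub>L real) set"
  assumes RNP: "dual_RNP TYPE('a)" and "A \<noteq> {}" and A: "A \<subseteq> cball 0 L" and "\<eta> > 0"
  obtains u s p where "\<exists>q\<in>A. blinfun_apply q u > s"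
    "\<And>q. q \<in> A \<Longrightarrow> blinfun_apply q u > s \<Longrightarrow> norm (q - p) < \<eta>"
proof -
  define K where "K = wstar_closed_convex_hull A"
  have AK: "A \<subseteq> K" unfolding K_def by (rule subset_wstar_hull)
  have "K \<subseteq> cball 0 L"
    unfolding K_def by (rule wstar_hull_minimal[OF closedin_wstar_cball convex_cball A])
  then have "compactin wstar_topology K"
    using closed_compactin[OF Banach_Alaoglu] closedin_wstar_hull unfolding K_def by blast
  moreover have "K \<noteq> {}" using AK \<open>A \<noteq> {}\<close> by blast
  ultimately have "K = wstar_closed_convex_hull (wstar_sexp_points K)"
    using RNP convex_wstar_hull[of A] unfolding dual_RNP_def K_def by blast
  \<comment> \<open>The empty set is its own hull, so the nonempty \<open>K\<close> has at least one
    strongly exposed point.\<close>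
  moreover have "wstar_closed_convex_hull {} = ({} :: ('a \<Rightarrow>\<^sub>L real) set)"
    using wstar_hull_minimal[of "{}" "{}"] by auto
  ultimately obtain p where "p \<in> wstar_sexp_points K"
    using \<open>K \<noteq> {}\<close> by fastforce
  then obtain u where "p \<in> K" and exposed: "\<And>q. (\<forall>n::nat. q n \<in> K) \<Longrightarrow>
      (\<lambda>n. ereal (blinfun_apply (q n) u)) \<longlonglongrightarrow> (SUP k\<in>K. ereal (blinfun_apply k u)) \<Longrightarrow> q \<longlonglongrightarrow> p"
    unfolding wstar_sexp_points_def by blast
  define \<sigma> where "\<sigma> = (SUP k\<in>K. blinfun_apply k u)"
  have bdd: "bdd_above ((\<lambda>k. blinfun_apply k u) ` K)"
  proof (rule bdd_aboveI2)
    fix k assume "k \<in> K"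
    then show "blinfun_apply k u \<le> L * norm u"
      using order_trans[OF norm_blinfun[of k u] mult_right_mono[of "norm k" L "norm u"]]
        \<open>K \<subseteq> cball 0 L\<close> by auto
  qed
  \<comment> \<open>\<open>K\<close> is bounded, so the extended supremum in the definition of
    exposure is the real number \<open>\<sigma>\<close>.\<close>
  have esig: "(SUP k\<in>K. ereal (blinfun_apply k u)) = ereal \<sigma>"
  proof (rule SUP_eqI)
    show "ereal (blinfun_apply k u) \<le> ereal \<sigma>" if "k \<in> K" for k
      unfolding \<sigma>_def using cSUP_upper[OF that bdd] by simp
    fix y assume y: "\<And>k. k \<in> K \<Longrightarrow> ereal (blinfun_apply k u) \<le> y"
    show "ereal \<sigma> \<le> y"
    proof (cases y)
      case (real r)
      then show ?thesis unfolding \<sigma>_def using y \<open>K \<noteq> {}\<close> by (auto intro: cSUP_least)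
    qed (use y[OF \<open>p \<in> K\<close>] in auto)
  qed
  \<comment> \<open>If every slice of depth 1/(n+1) had a point at distance at least
    \<open>\<eta>\<close> from \<open>p\<close>, these points would form a maximizing sequence that
    does not converge to \<open>p\<close>.\<close>
  have "\<exists>n::nat. \<forall>q\<in>K. blinfun_apply q u > \<sigma> - inverse (Suc n) \<longrightarrow> norm (q - p) < \<eta>"
  proof (rule ccontr)
    assume "\<not> ?thesis"
    then obtain q where q: "\<And>n. q n \<in> K" "\<And>n. blinfun_apply (q n) u > \<sigma> - inverse (Suc n)"
      "\<And>n. \<not> norm (q n - p) < \<eta>" by metis
    have "(\<lambda>n. blinfun_apply (q n) u) \<longlonglongrightarrow> \<sigma>"
    proof (rule tendsto_sandwich)
      show "(\<lambda>n. \<sigma> - inverse (real (Suc n))) \<longlonglongrightarrow> \<sigma>"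
        using tendsto_diff[OF tendsto_const LIMSEQ_inverse_real_of_nat, of \<sigma>] by simp
      show "\<forall>\<^sub>F n in sequentially. blinfun_apply (q n) u \<le> \<sigma>"
        unfolding \<sigma>_def using cSUP_upper[OF q(1) bdd] by simp
      show "\<forall>\<^sub>F n in sequentially. \<sigma> - inverse (real (Suc n)) \<le> blinfun_apply (q n) u"
        using q(2) by (intro always_eventually allI less_imp_le)
    qed simp
    then have "q \<longlonglongrightarrow> p" using exposed q(1) by (simp add: esig)
    then have "\<forall>\<^sub>F n in sequentially. dist (q n) p < \<eta>" using \<open>\<eta> > 0\<close> by (rule tendstoD)
    then show False using q(3) by (simp add: dist_norm)
  qed
  then obtain n :: nat where n: "\<And>q. q \<in> K \<Longrightarrow> blinfun_apply q u > \<sigma> - inverse (Suc n) \<Longrightarrow> norm (q - p) < \<eta>"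
    by blast
  have "\<exists>q\<in>A. blinfun_apply q u > \<sigma> - inverse (Suc n)"
  proof (rule ccontr)
    assume "\<not> ?thesis"
    then have "A \<subseteq> {q. blinfun_apply q u \<le> \<sigma> - inverse (Suc n)}" by (auto simp: not_less)
    then have "K \<subseteq> {q. blinfun_apply q u \<le> \<sigma> - inverse (Suc n)}"
      unfolding K_def using closedin_wstar_eval[of "{..\<sigma> - inverse (Suc n)}" u]
      by (intro wstar_hull_minimal convex_halfspace_eval) simp_all
    then have "\<sigma> \<le> \<sigma> - inverse (Suc n)"
      unfolding \<sigma>_def[symmetric] using cSUP_least[OF \<open>K \<noteq> {}\<close>, of "\<lambda>k. blinfun_apply k u" "\<sigma> - inverse (Suc n)"]
      by (auto simp: \<sigma>_def)
    then show False by (simp add: not_le)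
  qed
  with n AK show ?thesis using that[of "\<sigma> - inverse (Suc n)" u p] by blast
qed

text \<open>Weak separation without Hahn--Banach: the coefficients come from the nearest point to \<open>b\<close> in the
  closure of the image of \<open>C\<close> under the finitely many functionals.\<close>

lemma finite_functionals_separation:
  fixes l :: "'i \<Rightarrow> 'v::real_vector \<Rightarrow> real"
  assumes lin: "\<And>i. i \<in> I \<Longrightarrow> linear (l i)" and "convex C" and "C \<noteq> {}"
    and far: "\<And>c. c \<in> C \<Longrightarrow> (\<Sum>i\<in>I. (l i c - b i)\<^sup>2) \<ge> d"
  obtains a where "\<And>c. c \<in> C \<Longrightarrow> (\<Sum>i\<in>I. a i * (l i c - b i)) \<ge> d"
proof (cases "finite I")
  case False
  \<comment> \<open>Over an infinite index set all sums are 0 by convention, so \<open>far\<close>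
    forces \<open>d \<le> 0\<close>.\<close>
  with far \<open>C \<noteq> {}\<close> show ?thesis using that[of "\<lambda>_. 0"] by auto
next
  case True
  define S where "S c = (\<Sum>i\<in>I. (l i c - b i)\<^sup>2)" for c
  define m where "m = (INF c\<in>C. S c)"
  have bdd: "bdd_below (S ` C)"
    by (rule bdd_belowI2[of _ 0]) (simp add: S_def sum_nonneg)
  have ml: "m \<le> S c" if "c \<in> C" for c
    unfolding m_def by (rule cINF_lower[OF bdd that])
  have "d \<le> m" unfolding m_def using far \<open>C \<noteq> {}\<close> by (auto simp: S_def intro: cINF_greatest)
  have "\<exists>c\<in>C. S c < m + inverse (Suc n)" for n
    using cINF_less_iff[OF \<open>C \<noteq> {}\<close> bdd, of "m + inverse (Suc n)"] by (simp add: m_def[symmetric])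
  \<comment> \<open>A minimizing sequence for the squared distance \<open>S\<close>; the infimum
    need not be attained in \<open>C\<close>.\<close>
  then obtain z where zC: "\<And>n. z n \<in> C" and z: "\<And>n. S (z n) < m + inverse (Suc n)" by metis
  have comb: "l i (x *\<^sub>R c + y *\<^sub>R c') = x * l i c + y * l i c'" if "i \<in> I" for i x y c c'
    using lin[OF that] by (simp add: linear_add linear_scale)
  have close: "(l i (z n) - l i (z k))\<^sup>2 \<le> 2 * inverse (Suc n) + 2 * inverse (Suc k)" if "i \<in> I" for i n k
  proof -
    define w where "w = (1/2) *\<^sub>R z n + (1/2) *\<^sub>R z k"
    have "w \<in> C" unfolding w_def using \<open>convex C\<close> zC by (auto intro: convexD)
    \<comment> \<open>Parallelogram identity; the midpoint \<open>w\<close> lies in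
      \<open>C\<close>, so \<open>S w\<close> is at least \<open>m\<close>.\<close>
    have "(\<Sum>i\<in>I. (l i (z n) - l i (z k))\<^sup>2) = 2 * S (z n) + 2 * S (z k) - 4 * S w"
      unfolding S_def sum_distrib_left sum.distrib[symmetric] sum_subtractf[symmetric]
    proof (rule sum.cong[OF refl])
      fix i assume "i \<in> I"
      then show "(l i (z n) - l i (z k))\<^sup>2 = 2 * (l i (z n) - b i)\<^sup>2 + 2 * (l i (z k) - b i)\<^sup>2 - 4 * (l i w - b i)\<^sup>2"
        unfolding w_def by (simp add: comb power2_eq_square field_simps)
    qed
    moreover have "(l i (z n) - l i (z k))\<^sup>2 \<le> (\<Sum>i\<in>I. (l i (z n) - l i (z k))\<^sup>2)"
      using True that by (intro member_le_sum) auto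
    ultimately show ?thesis using z[of n] z[of k] ml[OF \<open>w \<in> C\<close>] by linarith
  qed
  have "Cauchy (\<lambda>n. l i (z n))" if "i \<in> I" for i
  proof (rule metric_CauchyI)
    fix e :: real assume "e > 0"
    then obtain N where N: "inverse (real (Suc N)) < e\<^sup>2 / 4"
      using reals_Archimedean[of "e\<^sup>2 / 4"] by auto
    have "dist (l i (z n)) (l i (z k)) < e" if "n \<ge> N" "k \<ge> N" for n k
    proof -
      have "inverse (real (Suc j)) \<le> inverse (real (Suc N))" if "j \<ge> N" for j
        using that by (simp add: field_simps)
      from this[OF that(1)] this[OF that(2)] have "(l i (z n) - l i (z k))\<^sup>2 < e\<^sup>2"
        using close[OF \<open>i \<in> I\<close>, of n k] N by linarith
      then show ?thesis
        using power2_less_imp_less[of "\<bar>l i (z n) - l i (z k)\<bar>" e] \<open>e > 0\<close>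
        by (simp add: dist_real_def)
    qed
    then show "\<exists>M. \<forall>m\<ge>M. \<forall>n\<ge>M. dist (l i (z m)) (l i (z n)) < e" by blast
  qed
  then have "\<exists>w. (\<lambda>n. l i (z n)) \<longlonglongrightarrow> w" if "i \<in> I" for i
    using that Cauchy_convergent_iff convergent_def by blast
  then obtain w where w: "\<And>i. i \<in> I \<Longrightarrow> (\<lambda>n. l i (z n)) \<longlonglongrightarrow> w i" by metis
  \<comment> \<open>\<open>w\<close> is the nearest point in the closure of the image of
    \<open>C\<close>, and \<open>a\<close> is the vector from \<open>b\<close> to it.\<close>
  define a where "a i = w i - b i" for i
  have lim: "(\<lambda>n. \<Sum>i\<in>I. ((1 - t) * l i (z n) + t * l i c - b i)\<^sup>2)
      \<longlonglongrightarrow> (\<Sum>i\<in>I. ((1 - t) * w i + t * l i c - b i)\<^sup>2)" for t c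
    by (intro tendsto_intros w)
  have a2: "(\<Sum>i\<in>I. (a i)\<^sup>2) = m"
  proof (rule LIMSEQ_unique)
    show "(\<lambda>n. S (z n)) \<longlonglongrightarrow> (\<Sum>i\<in>I. (a i)\<^sup>2)"
      using lim[of 0] by (simp add: S_def a_def)
    show "(\<lambda>n. S (z n)) \<longlonglongrightarrow> m"
    proof (rule tendsto_sandwich[of "\<lambda>_. m" _ _ "\<lambda>n. m + inverse (real (Suc n))"])
      show "(\<lambda>n. m + inverse (real (Suc n))) \<longlonglongrightarrow> m"
        using tendsto_add[OF tendsto_const LIMSEQ_inverse_real_of_nat, of m] by simp
      show "\<forall>\<^sub>F n in sequentially. S (z n) \<le> m + inverse (real (Suc n))"
        using z by (intro always_eventually allI less_imp_le)
      show "\<forall>\<^sub>F n in sequentially. m \<le> S (z n)" using ml[OF zC] by simp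
    qed simp
  qed
  have "d \<le> (\<Sum>i\<in>I. a i * (l i c - b i))" if "c \<in> C" for c
  proof -
    define P where "P = (\<Sum>i\<in>I. a i * (l i c - b i)) - m"
    define Q where "Q = (\<Sum>i\<in>I. (l i c - w i)\<^sup>2)"
    \<comment> \<open>Moving from \<open>z n\<close> towards \<open>c\<close> cannot bring
      \<open>S\<close> below \<open>m\<close>. Expanding the square in the limit over
      \<open>n\<close> and dividing by \<open>t\<close> leaves the first-order term
      \<open>2 * P\<close>, isolated below as \<open>t\<close> tends to 0.\<close>
    have ineq: "0 \<le> 2 * P + t * Q" if t: "0 < t" "t \<le> 1" for t
    proof -
      have "m \<le> (\<Sum>i\<in>I. ((1 - t) * w i + t * l i c - b i)\<^sup>2)"
      proof (rule LIMSEQ_le_const[OF lim])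
        show "\<exists>N. \<forall>n\<ge>N. m \<le> (\<Sum>i\<in>I. ((1 - t) * l i (z n) + t * l i c - b i)\<^sup>2)"
        proof (intro exI allI impI)
          fix n
          have "(1 - t) *\<^sub>R z n + t *\<^sub>R c \<in> C"
            using \<open>convex C\<close> zC \<open>c \<in> C\<close> t by (auto intro: convexD)
          from ml[OF this] show "m \<le> (\<Sum>i\<in>I. ((1 - t) * l i (z n) + t * l i c - b i)\<^sup>2)"
            by (simp add: S_def comb cong: sum.cong)
        qed
      qed
      also have "\<dots> = (\<Sum>i\<in>I. (a i)\<^sup>2 + (2 * t * (a i * (l i c - b i) - (a i)\<^sup>2) + t\<^sup>2 * (l i c - w i)\<^sup>2))"
        by (rule sum.cong) (auto simp: a_def power2_eq_square algebra_simps)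
      also have "\<dots> = m + (2 * t * P + t\<^sup>2 * Q)"
        by (simp add: sum.distrib sum_subtractf sum_distrib_left[symmetric] a2 P_def Q_def)
      finally have "0 \<le> t * (2 * P + t * Q)" by (simp add: power2_eq_square algebra_simps)
      then show ?thesis using t(1) by (simp add: zero_le_mult_iff)
    qed
    have "0 \<le> 2 * P"
    proof (rule tendsto_lowerbound)
      show "((\<lambda>t. 2 * P + t * Q) \<longlongrightarrow> 2 * P) (at_right 0)"
        by (rule tendsto_eq_intros refl | simp)+
      show "\<forall>\<^sub>F t in at_right 0. 0 \<le> 2 * P + t * Q"
        unfolding eventually_at_right[OF zero_less_one] using ineq by (intro exI[of _ 1]) auto
    qed simp
    then have "m \<le> (\<Sum>i\<in>I. a i * (l i c - b i))" by (simp add: P_def)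
    with \<open>d \<le> m\<close> show ?thesis by (rule order_trans)
  qed
  then show ?thesis by (rule that)
qed

section \<open>The conjugate and its continuity\<close>

text \<open>The functional is tested at distance \<open>\<delta> / 2\<close> from \<open>x\<close>,
  inside the open ball; this is the source of the factor 2.\<close>

lemma norm_blinfun_le_of_ball:
  fixes q :: "'a::real_normed_vector \<Rightarrow>\<^sub>L real"
  assumes "\<delta> > 0" and le: "\<And>y. y \<in> ball x \<delta> \<Longrightarrow> blinfun_apply q (y - x) \<le> M"
  shows "norm q \<le> 2 * M / \<delta>"
proof -
  have "M \<ge> 0" using le[of x] \<open>\<delta> > 0\<close> by simp
  have *: "blinfun_apply q v \<le> 2 * M / \<delta> * norm v" for v
  proof (cases "v = 0")
    case False
    then have "x + (\<delta> / (2 * norm v)) *\<^sub>R v \<in> ball x \<delta>" using \<open>\<delta> > 0\<close> by (simp add: dist_norm)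
    from le[OF this] have "\<delta> / (2 * norm v) * blinfun_apply q v \<le> M"
      by (simp add: blinfun.scaleR_right)
    then show ?thesis using False \<open>\<delta> > 0\<close> by (simp add: field_simps)
  qed simp
  show ?thesis
  proof (rule norm_blinfun_bound)
    show "norm (blinfun_apply q v) \<le> 2 * M / \<delta> * norm v" for v
      using *[of v] *[of "- v"] by (simp add: blinfun.minus_right abs_le_iff)
  qed (use \<open>M \<ge> 0\<close> \<open>\<delta> > 0\<close> in simp)
qed

locale wstar_epi_pointed_fun =
  fixes g :: "('a::banach \<Rightarrow>\<^sub>L real) \<Rightarrow> ereal"
  assumes proper: "proper_fun g" and convex: "convex_fun g" and lsc: "wstar_lsc g"
    and pointed: "wstar_epi_pointed g"
begin

text \<open>\<open>D\<close> and \<open>F\<close> are the domain and the real values (junk off \<open>D\<close>) of \<open>g\<^sup>*|\<^sub>X\<close>.\<close>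

definition D :: "'a set" where "D = {x. conj_X g x < \<infinity>}"

definition F :: "'a \<Rightarrow> real" where "F x = real_of_ereal (conj_X g x)"

lemma mem_epi: "(q, r) \<in> epi g \<longleftrightarrow> g q \<le> ereal r"
  by (simp add: epi_def)

lemma not_MInf: "g q \<noteq> -\<infinity>"
  using proper by (simp add: proper_fun_def)

lemma epi_nonempty: "epi g \<noteq> {}"
proof -
  obtain q where "g q \<noteq> \<infinity>" using proper by (auto simp: proper_fun_def)
  then have "g q = ereal (real_of_ereal (g q))" using not_MInf[of q] by (cases "g q") auto
  then have "(q, real_of_ereal (g q)) \<in> epi g" by (simp add: mem_epi)
  then show ?thesis by blast
qed

text \<open>Passing to the points of the epigraph, whose heights are real, avoids subtracting
  infinite values.\<close>

lemma conj_le_iff: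
  "conj_X g x \<le> ereal m \<longleftrightarrow> (\<forall>q r. (q, r) \<in> epi g \<longrightarrow> blinfun_apply q x - r \<le> m)"
proof -
  have "ereal (blinfun_apply q x) - g q \<le> ereal m
      \<longleftrightarrow> (\<forall>r. (q, r) \<in> epi g \<longrightarrow> blinfun_apply q x - r \<le> m)" for q
    using not_MInf[of q] by (cases "g q") (auto simp: mem_epi)
  then show ?thesis by (simp add: conj_X_def SUP_le_iff)
qed

lemma conj_eq_F: "x \<in> D \<Longrightarrow> conj_X g x = ereal (F x)"
proof -
  assume "x \<in> D"
  obtain q r where qr: "(q, r) \<in> epi g" using epi_nonempty by fastforce
  have "conj_X g x \<noteq> -\<infinity>"
  proof
    assume "conj_X g x = -\<infinity>"
    then have "conj_X g x \<le> ereal (blinfun_apply q x - r - 1)" by simp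
    then show False using qr unfolding conj_le_iff by force
  qed
  with \<open>x \<in> D\<close> show ?thesis unfolding F_def D_def by (cases "conj_X g x") auto
qed

lemma F_le_iff: "x \<in> D \<Longrightarrow> F x \<le> m \<longleftrightarrow> (\<forall>q r. (q, r) \<in> epi g \<longrightarrow> blinfun_apply q x - r \<le> m)"
  using conj_le_iff[of x m] by (simp add: conj_eq_F)

lemma F_leI:
  assumes "\<And>q r. (q, r) \<in> epi g \<Longrightarrow> blinfun_apply q x - r \<le> m"
  shows "x \<in> D" "F x \<le> m"
proof -
  have "conj_X g x \<le> ereal m" using assms conj_le_iff by blast
  then show "x \<in> D" unfolding D_def using le_less_trans by fastforce
  then show "F x \<le> m" using F_le_iff assms by blast
qed

lemma Fenchel_Young: "x \<in> D \<Longrightarrow> (q, r) \<in> epi g \<Longrightarrow> blinfun_apply q x - r \<le> F x"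
  using F_le_iff[of x "F x"] by blast

lemma F_approx:
  assumes "x \<in> D" "e > 0"
  obtains q r where "(q, r) \<in> epi g" "blinfun_apply q x - r > F x - e"
  using F_le_iff[OF assms(1), of "F x - e"] assms(2) by (force simp: not_le)

text \<open>\<open>F\<close> is a supremum of affine functions; bounding each of them at a convex
  combination yields the convexity of \<open>D\<close> at the same time.\<close>

lemma convex_on_F: "convex_on D F"
proof -
  have *: "(1 - t) *\<^sub>R x + t *\<^sub>R y \<in> D \<and> F ((1 - t) *\<^sub>R x + t *\<^sub>R y) \<le> (1 - t) * F x + t * F y"
    if "t \<ge> 0" "t \<le> 1" "x \<in> D" "y \<in> D" for t x y
  proof -
    have "blinfun_apply q ((1 - t) *\<^sub>R x + t *\<^sub>R y) - r \<le> (1 - t) * F x + t * F y"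
      if "(q, r) \<in> epi g" for q r
    proof -
      have "(1 - t) * (blinfun_apply q x - r) + t * (blinfun_apply q y - r) \<le> (1 - t) * F x + t * F y"
        using Fenchel_Young[OF \<open>x \<in> D\<close> that] Fenchel_Young[OF \<open>y \<in> D\<close> that] \<open>t \<ge> 0\<close> \<open>t \<le> 1\<close>
        by (intro add_mono mult_left_mono) auto
      moreover have "blinfun_apply q ((1 - t) *\<^sub>R x + t *\<^sub>R y)
          = (1 - t) * blinfun_apply q x + t * blinfun_apply q y"
        by (simp only: blinfun.add_right blinfun.scaleR_right real_scaleR_def)
      ultimately show ?thesis by (simp add: algebra_simps)
    qed
    then show ?thesis using F_leI by blast
  qed
  then have "convex D" unfolding convex_alt by blast
  with * show ?thesis by (intro convex_onI) auto
qed

lemma convex_D: "convex D"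
  using convex_on_F by (rule convex_on_imp_convex)

lemma interior_D_nonempty: "interior D \<noteq> {}"
  using pointed by (simp add: wstar_epi_pointed_def D_def)

text \<open>An intersection of sublevel sets of continuous affine functions; Baire's theorem will be
  applied to these sets.\<close>

lemma closed_conj_sublevel: "closed {x. conj_X g x \<le> ereal m}"
proof -
  have "{x. conj_X g x \<le> ereal m} = (\<Inter>(q, r)\<in>epi g. {x. blinfun_apply q x - r \<le> m})"
    by (auto simp: conj_le_iff)
  also have "closed \<dots>"
    by (intro closed_INT ballI) (auto intro!: closed_Collect_le continuous_intros)
  finally show ?thesis .
qed

text \<open>A non-vertical separating functional gives the point directly; moving far along a vertical one
  makes \<open>\<langle>p, x\<rangle> - F x\<close> arbitrarily large.\<close>

lemma Fenchel_Moreau: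
  assumes "ereal r < g p"
  obtains x where "x \<in> D" "blinfun_apply p x - F x > r"
proof -
  \<comment> \<open>The level \<open>s\<close> keeps \<open>(p, r)\<close> away from the epigraph:
    up to height \<open>s\<close> some coordinate from \<open>Y\<close> differs by at least
    \<open>d\<close>, above it the heights differ by more than \<open>s - r\<close>.\<close>
  obtain s where s: "ereal r < ereal s" "ereal s < g p"
    using ereal_dense2[OF assms] by blast
  have "closedin wstar_topology {q. g q \<le> ereal s}" using lsc by (simp add: wstar_lsc_def)
  then obtain Y d where Y: "finite Y" "d > 0"
    and sep: "\<And>q. q \<in> {q. g q \<le> ereal s} \<Longrightarrow> \<exists>x\<in>Y. \<bar>blinfun_apply q x - blinfun_apply p x\<bar> \<ge> d"
    using s(2) closedin_wstar_separated[of "{q. g q \<le> ereal s}" p] by (auto simp: not_le)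
  define \<delta> where "\<delta> = min (d\<^sup>2) ((s - r)\<^sup>2)"
  have "\<delta> > 0" using Y s by (simp add: \<delta>_def)
  \<comment> \<open>The index \<open>None\<close> stands for the height, \<open>Some x\<close> for
    evaluation at \<open>x\<close>.\<close>
  define l where "l i c = (case i of None \<Rightarrow> snd c | Some x \<Rightarrow> blinfun_apply (fst c) x)"
    for i :: "'a option" and c :: "('a \<Rightarrow>\<^sub>L real) \<times> real"
  define b where "b i = (case i of None \<Rightarrow> r | Some x \<Rightarrow> blinfun_apply p x)" for i
  define I where "I = insert None (Some ` Y)"
  have sumI: "(\<Sum>i\<in>I. h i) = h None + (\<Sum>x\<in>Y. h (Some x))" for h :: "'a option \<Rightarrow> real"
    unfolding I_def using Y(1) by (simp add: sum.reindex)
  have far: "\<delta> \<le> (\<Sum>i\<in>I. (l i c - b i)\<^sup>2)" if "c \<in> epi g" for c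
  proof -
    obtain q t where c: "c = (q, t)" by fastforce
    have sum: "(\<Sum>i\<in>I. (l i c - b i)\<^sup>2) = (t - r)\<^sup>2 + (\<Sum>x\<in>Y. (blinfun_apply q x - blinfun_apply p x)\<^sup>2)"
      by (simp add: sumI l_def b_def c)
    show ?thesis
    proof (cases "t \<le> s")
      case True
      then have "g q \<le> ereal s" using that c order_trans by (fastforce simp: mem_epi)
      then obtain x where "x \<in> Y" "\<bar>blinfun_apply q x - blinfun_apply p x\<bar> \<ge> d" using sep by blast
      then have "d\<^sup>2 \<le> (blinfun_apply q x - blinfun_apply p x)\<^sup>2"
        using Y(2) by (simp add: abs_le_square_iff[symmetric])
      also have "\<dots> \<le> (\<Sum>x\<in>Y. (blinfun_apply q x - blinfun_apply p x)\<^sup>2)"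
        by (rule member_le_sum) (use \<open>x \<in> Y\<close> Y(1) in auto)
      finally show ?thesis unfolding sum \<delta>_def by (simp add: add_increasing min.coboundedI1)
    next
      case False
      then have "(s - r)\<^sup>2 \<le> (t - r)\<^sup>2" using s(1) by (intro power_mono) auto
      then show ?thesis unfolding sum \<delta>_def
        by (intro min.coboundedI2) (simp add: sum_nonneg add_increasing2)
    qed
  qed
  have "linear (l i)" for i
    by (cases i) (auto simp: l_def linear_iff blinfun.add_left blinfun.scaleR_left)
  then obtain a where a: "\<And>c. c \<in> epi g \<Longrightarrow> \<delta> \<le> (\<Sum>i\<in>I. a i * (l i c - b i))"
    using finite_functionals_separation[of I l "epi g" \<delta> b] convex far epi_nonempty
    unfolding convex_fun_def by blast
  define \<beta> where "\<beta> = a None"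
  define u where "u = (\<Sum>x\<in>Y. a (Some x) *\<^sub>R x)"
  have key: "\<delta> \<le> \<beta> * (t - r) + (blinfun_apply q u - blinfun_apply p u)" if "(q, t) \<in> epi g" for q t
    using a[OF that] by (simp add: sumI l_def b_def \<beta>_def u_def blinfun.sum_right blinfun.scaleR_right
        right_diff_distrib sum_subtractf)
  \<comment> \<open>The epigraph is closed upwards, so a negative \<open>\<beta>\<close> would
    violate \<open>key\<close> at a large height.\<close>
  have "\<beta> \<ge> 0"
  proof (rule ccontr)
    assume neg: "\<not> \<beta> \<ge> 0"
    obtain q t where qt: "(q, t) \<in> epi g" using epi_nonempty by fastforce
    define t' where "t' = max t (r + (blinfun_apply q u - blinfun_apply p u) / (- \<beta>))"
    have "(q, t') \<in> epi g" using qt order_trans unfolding mem_epi t'_def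
      by (metis ereal_less_eq(3) max.cobounded1)
    from key[OF this] have "\<delta> \<le> \<beta> * (t' - r) + (blinfun_apply q u - blinfun_apply p u)" .
    moreover have "(blinfun_apply q u - blinfun_apply p u) / (- \<beta>) \<le> t' - r" by (simp add: t'_def)
    then have "\<beta> * (t' - r) \<le> \<beta> * ((blinfun_apply q u - blinfun_apply p u) / (- \<beta>))"
      using neg by (intro mult_left_mono_neg) auto
    ultimately show False using neg \<open>\<delta> > 0\<close> by simp
  qed
  then consider "\<beta> > 0" | "\<beta> = 0" by linarith
  then show ?thesis
  proof cases
    case 1
    \<comment> \<open>Dividing by \<open>- \<beta>\<close> normalizes the coefficient of the height
      to -1, as in the conjugate.\<close>
    define x where "x = (- 1 / \<beta>) *\<^sub>R u"
    have ux: "blinfun_apply q x = - (blinfun_apply q u / \<beta>)" for q :: "'a \<Rightarrow>\<^sub>L real"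
      unfolding x_def by (simp only: blinfun.scaleR_right) simp
    have "blinfun_apply q x - t \<le> blinfun_apply p x - r - \<delta> / \<beta>" if "(q, t) \<in> epi g" for q t
      using divide_right_mono[OF key[OF that], of \<beta>] 1
      by (simp add: ux add_divide_distrib diff_divide_distrib)
    from F_leI[OF this] have "x \<in> D" "F x \<le> blinfun_apply p x - r - \<delta> / \<beta>" by blast+
    moreover have "\<delta> / \<beta> > 0" using 1 \<open>\<delta> > 0\<close> by simp
    ultimately show ?thesis using that[of x] by linarith
  next
    case 2
    obtain y where "y \<in> D" using interior_D_nonempty interior_subset by blast
    \<comment> \<open>\<open>k * \<delta>\<close> exceeds the absolute deficit at \<open>y\<close>
      by 1, so the gain from moving along \<open>- u\<close> outweighs it.\<close>
    define k where "k = (\<bar>r - blinfun_apply p y + F y\<bar> + 1) / \<delta>"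
    have k: "k \<ge> 0" "k * \<delta> = \<bar>r - blinfun_apply p y + F y\<bar> + 1" using \<open>\<delta> > 0\<close> by (simp_all add: k_def)
    define x where "x = y - k *\<^sub>R u"
    have "blinfun_apply q x - t \<le> F y - k * (blinfun_apply p u + \<delta>)" if "(q, t) \<in> epi g" for q t
    proof -
      have "k * (blinfun_apply p u + \<delta>) \<le> k * blinfun_apply q u"
        using key[OF that] 2 k(1) by (intro mult_left_mono) auto
      then show ?thesis using Fenchel_Young[OF \<open>y \<in> D\<close> that]
        by (simp add: x_def blinfun.diff_right blinfun.scaleR_right)
    qed
    from F_leI[OF this] have "x \<in> D" "F x \<le> F y - k * (blinfun_apply p u + \<delta>)" by blast+
    moreover have "blinfun_apply p x = blinfun_apply p y - k * blinfun_apply p u"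
      by (simp add: x_def blinfun.diff_right blinfun.scaleR_right)
    ultimately have "x \<in> D" "blinfun_apply p x - F x > r" using k(2) by (simp_all add: distrib_left)
    then show ?thesis using that by blast
  qed
qed

text \<open>Contrapositive of Fenchel--Moreau: \<open>g\<close> is recovered as the conjugate of
  \<open>F\<close>.\<close>

lemma mem_epiI:
  assumes "\<And>x. x \<in> D \<Longrightarrow> blinfun_apply p x - F x \<le> r"
  shows "(p, r) \<in> epi g"
  using Fenchel_Moreau[of r p] assms by (force simp: mem_epi not_le[symmetric])

text \<open>Baire's theorem on the closed sublevel sets bounds \<open>F\<close> on a ball around
  some \<open>y\<close>. Convexity carries the bound to \<open>x\<close> by a homothety centred at a
  point \<open>w\<close> of \<open>D\<close> beyond \<open>x\<close>.\<close>

lemma F_locally_bounded_above: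
  assumes "x \<in> interior D"
  obtains e b where "e > 0" "cball x e \<subseteq> D" "\<And>z. z \<in> cball x e \<Longrightarrow> F z \<le> b"
proof -
  have "\<exists>n::nat. interior {x. conj_X g x \<le> ereal (real n)} \<noteq> {}"
  proof (rule ccontr)
    assume no: "\<not> ?thesis"
    have "interior (\<Union>n::nat. {x. conj_X g x \<le> ereal (real n)}) = {}"
      using Baire_category_alt[of "euclidean :: 'a topology" "range (\<lambda>n::nat. {x. conj_X g x \<le> ereal (real n)})"]
        no closed_conj_sublevel completely_metrizable_space_euclidean by auto
    moreover have "D \<subseteq> (\<Union>n::nat. {x. conj_X g x \<le> ereal (real n)})"
      using real_arch_simple by (auto simp: conj_eq_F)
    ultimately show False using interior_mono interior_D_nonempty by blast
  qed
  then obtain n y \<rho> where \<rho>: "\<rho> > 0" "cball y \<rho> \<subseteq> {x. conj_X g x \<le> ereal (real n)}"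
    by (meson ex_in_conv mem_interior_cball)
  have y: "z \<in> D \<and> F z \<le> n" if "z \<in> cball y \<rho>" for z
  proof -
    have "conj_X g z \<le> ereal (real n)" using \<rho> that by blast
    then have "z \<in> D" unfolding D_def using le_less_trans by fastforce
    with \<open>conj_X g z \<le> ereal (real n)\<close> show ?thesis by (simp add: conj_eq_F)
  qed
  \<comment> \<open>Since \<open>x\<close> is interior, the ray from \<open>y\<close> through
    \<open>x\<close> can be prolonged a little inside \<open>D\<close>.\<close>
  have "((\<lambda>s. x + s *\<^sub>R (x - y)) \<longlongrightarrow> x + 0 *\<^sub>R (x - y)) (at_right 0)" by (intro tendsto_intros)
  then have "\<forall>\<^sub>F s in at_right 0. x + s *\<^sub>R (x - y) \<in> interior D"
    using assms by (intro topological_tendstoD) auto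
  then have "\<forall>\<^sub>F s::real in at_right 0. s > 0 \<and> x + s *\<^sub>R (x - y) \<in> D"
    using eventually_at_right_less[of "0::real"] interior_subset by (fastforce elim: eventually_elim2)
  then obtain s :: real where s: "s > 0" "x + s *\<^sub>R (x - y) \<in> D"
    using eventually_happens[of _ "at_right (0::real)"] by auto
  define w where "w = x + s *\<^sub>R (x - y)"
  define t where "t = s / (1 + s)"
  have t: "0 < t" "t < 1" using s by (auto simp: t_def)
  have xw: "x = (1 - t) *\<^sub>R w + t *\<^sub>R y"
  proof -
    have "(1 - t) * (1 + s) = 1" "(1 - t) * s = t" using s by (simp_all add: t_def field_simps)
    moreover have "(1 - t) *\<^sub>R w + t *\<^sub>R y = ((1 - t) * (1 + s)) *\<^sub>R x + (t - (1 - t) * s) *\<^sub>R y"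
      by (simp add: w_def algebra_simps)
    ultimately show ?thesis by simp
  qed
  have *: "z \<in> D \<and> F z \<le> (1 - t) * F w + t * n" if "z \<in> cball x (t * \<rho>)" for z
  proof -
    \<comment> \<open>The preimage of \<open>z\<close> under the homothety with centre
      \<open>w\<close> and ratio \<open>t\<close>.\<close>
    define v where "v = y + (1 / t) *\<^sub>R (z - x)"
    have "norm (z - x) \<le> t * \<rho>" using that by (simp add: dist_norm norm_minus_commute)
    then have "norm ((1 / t) *\<^sub>R (z - x)) \<le> \<rho>"
      unfolding norm_scaleR using t by (simp add: field_simps)
    then have "v \<in> cball y \<rho>" by (simp add: v_def dist_norm del: norm_scaleR)
    then have v: "v \<in> D" "F v \<le> n" using y by blast+
    have z: "z = (1 - t) *\<^sub>R w + t *\<^sub>R v"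
      using t xw by (simp add: v_def scaleR_add_right)
    have "z \<in> D" unfolding z using convex_D s(2) v t unfolding w_def[symmetric] by (intro convexD) auto
    have "F z \<le> (1 - t) * F w + t * F v"
      unfolding z using t s(2) v convex_onD[OF convex_on_F] by (simp add: w_def)
    also have "\<dots> \<le> (1 - t) * F w + t * n" using t v by (intro add_left_mono mult_left_mono) auto
    finally show ?thesis using \<open>z \<in> D\<close> by blast
  qed
  show ?thesis
    by (rule that[of "t * \<rho>" "(1 - t) * F w + t * n"]) (use * t \<rho> in auto)
qed

text \<open>A convex function bounded above on a ball is also bounded below there, by reflection in
  the centre, and is therefore continuous.\<close>

lemma isCont_F:
  assumes "x \<in> interior D"
  shows "isCont F x"
proof -
  obtain e b where e: "e > 0" "cball x e \<subseteq> D" and b: "\<And>z. z \<in> cball x e \<Longrightarrow> F z \<le> b"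
    using F_locally_bounded_above[OF assms] by blast
  have cv: "convex_on (cball x e) F"
    using convex_on_subset[OF convex_on_F e(2)] by simp
  have "continuous_on (ball x e) F"
  proof (rule convex_on_bounded_continuous)
    show "convex_on (ball x e) F" by (rule convex_on_subset[OF cv]) auto
    show "\<forall>z\<in>ball x e. \<bar>F z\<bar> \<le> b + 2 * \<bar>F x\<bar>"
      using convex_bounds_lemma[OF cv b] by auto
  qed simp
  then show ?thesis using e(1) continuous_on_eq_continuous_at[OF open_ball] by (metis centre_in_ball)
qed

subsection \<open>Subgradients and generic Frechet differentiability\<close>

text \<open>\<open>subgrad x\<close> is the subdifferential of \<open>F\<close> at \<open>x\<close>, written as equality in the Fenchel--Young
  inequality.\<close>

definition subgrad :: "'a \<Rightarrow> ('a \<Rightarrow>\<^sub>L real) set" where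
  "subgrad x = {q. (q, blinfun_apply q x - F x) \<in> epi g}"

lemma mem_subgrad_iff:
  assumes "x \<in> D"
  shows "q \<in> subgrad x \<longleftrightarrow> (\<forall>y\<in>D. blinfun_apply q (y - x) \<le> F y - F x)"
proof
  assume "q \<in> subgrad x"
  then show "\<forall>y\<in>D. blinfun_apply q (y - x) \<le> F y - F x"
    using Fenchel_Young by (fastforce simp: subgrad_def blinfun.diff_right)
next
  assume *: "\<forall>y\<in>D. blinfun_apply q (y - x) \<le> F y - F x"
  show "q \<in> subgrad x"
    unfolding subgrad_def mem_Collect_eq
    by (rule mem_epiI) (use * in \<open>force simp: blinfun.diff_right\<close>)
qed

lemma subgrad_le: "x \<in> D \<Longrightarrow> y \<in> D \<Longrightarrow> q \<in> subgrad x \<Longrightarrow> blinfun_apply q (y - x) \<le> F y - F x"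
  using mem_subgrad_iff by blast

lemma subgrad_imp_g_eq:
  assumes "x \<in> D" "q \<in> subgrad x"
  shows "g q = ereal (blinfun_apply q x - F x)"
proof -
  have le: "g q \<le> ereal (blinfun_apply q x - F x)" using assms(2) by (simp add: subgrad_def mem_epi)
  then obtain r where r: "g q = ereal r" using not_MInf[of q] by (cases "g q") auto
  then have "blinfun_apply q x - r \<le> F x" using Fenchel_Young[OF assms(1), of q r] by (simp add: mem_epi)
  with le r show ?thesis by simp
qed

text \<open>Equality in Fenchel--Young is symmetric in point and functional, so the subdifferential
  of \<open>g\<close> within \<open>X\<close> is the inverse relation of that of \<open>F\<close>.
  The chains can thus be built from points of \<open>X\<close>.\<close>

lemma mem_subdiff_X_iff: "x \<in> subdiff_X g q \<longleftrightarrow> x \<in> D \<and> q \<in> subgrad x"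
proof
  assume x: "x \<in> subdiff_X g q"
  then obtain r where r: "g q = ereal r"
    using not_MInf[of q] by (cases "g q") (auto simp: subdiff_X_def)
  have "blinfun_apply h x - s \<le> blinfun_apply q x - r" if "(h, s) \<in> epi g" for h s
  proof -
    have "ereal (blinfun_apply h x - blinfun_apply q x) \<le> g h - ereal r"
      using x r by (simp add: subdiff_X_def)
    moreover have "g h \<le> ereal s" using that by (simp add: mem_epi)
    ultimately have "ereal (blinfun_apply h x - blinfun_apply q x) \<le> ereal s - ereal r"
      by (meson ereal_minus_mono order_refl order_trans)
    then show ?thesis by simp
  qed
  from F_leI[OF this] have "x \<in> D" "F x \<le> blinfun_apply q x - r" by blast+
  then show "x \<in> D \<and> q \<in> subgrad x" using r by (simp add: subgrad_def mem_epi)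
next
  assume x: "x \<in> D \<and> q \<in> subgrad x"
  then have gq: "g q = ereal (blinfun_apply q x - F x)" using subgrad_imp_g_eq by blast
  have "ereal (blinfun_apply h x - blinfun_apply q x) \<le> g h - g q" for h
  proof (cases "g h")
    case (real r)
    then show ?thesis using Fenchel_Young[of x h r] x by (simp add: gq mem_epi)
  qed (use not_MInf[of h] in \<open>auto simp: gq\<close>)
  then show "x \<in> subdiff_X g q" by (simp add: subdiff_X_def gq)
qed

lemma subgrad_monotone:
  assumes "x \<in> D" "y \<in> D" "p \<in> subgrad x" "q \<in> subgrad y"
  shows "0 \<le> blinfun_apply (q - p) (y - x)"
proof -
  have "blinfun_apply q (x - y) \<le> F x - F y" "blinfun_apply p (y - x) \<le> F y - F x"
    using subgrad_le assms by blast+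
  then show ?thesis by (simp add: blinfun.diff_left blinfun.diff_right)
qed

lemma F_ball_close:
  assumes "x \<in> interior D" "e > 0"
  obtains \<delta> where "\<delta> > 0" "ball x \<delta> \<subseteq> D" "\<And>y. y \<in> ball x \<delta> \<Longrightarrow> \<bar>F y - F x\<bar> < e"
proof -
  have "\<forall>\<^sub>F y in nhds x. dist (F y) (F x) < e"
    using isCont_F[OF assms(1)] assms(2) unfolding continuous_within tendsto_at_iff_tendsto_nhds
    by (rule tendstoD)
  then obtain d where d: "d > 0" "\<And>y. dist y x < d \<Longrightarrow> dist (F y) (F x) < e"
    by (auto simp: eventually_nhds_metric)
  obtain c where "c > 0" "ball x c \<subseteq> D" using assms(1) by (auto simp: mem_interior)
  with d show ?thesis
    by (intro that[of "min c d"]) (auto simp: dist_real_def dist_commute)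
qed

text \<open>The approximate subgradients with error 1/(n+1) form a decreasing sequence of nonempty
  weak* closed subsets of one ball, so compactness gives a common element.\<close>

lemma subgrad_nonempty:
  assumes x: "x \<in> interior D"
  shows "subgrad x \<noteq> {}"
proof -
  have "x \<in> D" using x interior_subset by blast
  obtain \<delta> where \<delta>: "\<delta> > 0" "ball x \<delta> \<subseteq> D" "\<And>y. y \<in> ball x \<delta> \<Longrightarrow> \<bar>F y - F x\<bar> < 1"
    using F_ball_close[OF x zero_less_one] by blast
  define C where "C n = {q. \<forall>y\<in>D. blinfun_apply q (y - x) \<le> F y - F x + inverse (Suc n)}" for n :: nat
  define B where "B = cball (0 :: 'a \<Rightarrow>\<^sub>L real) (4 / \<delta>)"
  have CB: "C n \<subseteq> B" for n
  proof
    fix q assume q: "q \<in> C n"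
    have "inverse (real (Suc n)) \<le> 1" by (simp add: inverse_le_1_iff)
    then have "blinfun_apply q (y - x) \<le> 2" if "y \<in> ball x \<delta>" for y
      using q \<delta>(2) \<delta>(3)[OF that] that by (fastforce simp: C_def)
    from norm_blinfun_le_of_ball[OF \<delta>(1) this] show "q \<in> B" by (simp add: B_def)
  qed
  have "(\<Inter>n. C n) \<noteq> {}"
  proof (rule compact_space_imp_nest)
    show "compact_space (subtopology wstar_topology B)"
      unfolding B_def by (intro compact_space_subtopology Banach_Alaoglu)
    show "closedin (subtopology wstar_topology B) (C n)" for n
    proof -
      have "C n = (\<Inter>y\<in>D. {q. blinfun_apply q (y - x) \<in> {..F y - F x + inverse (Suc n)}})"
        by (auto simp: C_def)
      moreover have "closedin wstar_topology \<dots>"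
        by (intro closedin_INT closedin_wstar_eval) (use \<open>x \<in> D\<close> in auto)
      ultimately show ?thesis using CB closedin_subset_topspace by metis
    qed
    show "C n \<noteq> {}" for n
    \<comment> \<open>An epigraph point that nearly attains the supremum \<open>F x\<close> gives an
      approximate subgradient.\<close>
    proof -
      obtain q r where qr: "(q, r) \<in> epi g" "blinfun_apply q x - r > F x - inverse (Suc n)"
        using F_approx[OF \<open>x \<in> D\<close>, of "inverse (Suc n)"] by auto
      then have "q \<in> C n"
        using Fenchel_Young[OF _ qr(1)] by (fastforce simp: C_def blinfun.diff_right)
      then show ?thesis by blast
    qed
    show "decseq C"
    proof (rule decseq_SucI)
      fix n
      have "inverse (real (Suc (Suc n))) \<le> inverse (real (Suc n))" by simp
      then have "F y - F x + inverse (real (Suc (Suc n))) \<le> F y - F x + inverse (real (Suc n))" for y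
        by (rule add_left_mono)
      then show "C (Suc n) \<subseteq> C n" unfolding C_def by (blast intro: order_trans)
    qed
  qed
  then obtain q where q: "\<And>n. q \<in> C n" by blast
  have "blinfun_apply q (y - x) \<le> F y - F x" if "y \<in> D" for y
  proof (rule LIMSEQ_le_const)
    show "(\<lambda>n. F y - F x + inverse (real (Suc n))) \<longlonglongrightarrow> F y - F x"
      using tendsto_add[OF tendsto_const LIMSEQ_inverse_real_of_nat, of "F y - F x"] by simp
    show "\<exists>N. \<forall>n\<ge>N. blinfun_apply q (y - x) \<le> F y - F x + inverse (real (Suc n))"
      using q that by (auto simp: C_def)
  qed
  then show ?thesis using mem_subgrad_iff[OF \<open>x \<in> D\<close>] by blast
qed

text \<open>\<open>F\<close> varies by less than 2 on a ball around \<open>x\<close>, and half of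
  its radius remains available around every \<open>z\<close> in the smaller ball.\<close>

lemma subgrad_locally_bounded:
  assumes x: "x \<in> interior D"
  obtains \<delta> L where "\<delta> > 0" "ball x \<delta> \<subseteq> D" "\<And>z q. z \<in> ball x \<delta> \<Longrightarrow> q \<in> subgrad z \<Longrightarrow> norm q \<le> L"
proof -
  obtain \<delta> where \<delta>: "\<delta> > 0" "ball x \<delta> \<subseteq> D" "\<And>y. y \<in> ball x \<delta> \<Longrightarrow> \<bar>F y - F x\<bar> < 1"
    using F_ball_close[OF x zero_less_one] by blast
  have "norm q \<le> 2 * 2 / (\<delta> / 2)" if z: "z \<in> ball x (\<delta> / 2)" and q: "q \<in> subgrad z" for z q
  proof (rule norm_blinfun_le_of_ball)
    fix y assume y: "y \<in> ball z (\<delta> / 2)"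
    have zd: "z \<in> ball x \<delta>" using z \<delta>(1) by auto
    have yd: "y \<in> ball x \<delta>" using y z dist_triangle_half_r[of z x \<delta> y] dist_triangle[of x y z] by auto
    have "blinfun_apply q (y - z) \<le> F y - F z" using subgrad_le q zd yd \<delta>(2) by blast
    then show "blinfun_apply q (y - z) \<le> 2" using \<delta>(3)[OF zd] \<delta>(3)[OF yd] by linarith
  qed (use \<delta> in auto)
  moreover have "ball x (\<delta> / 2) \<subseteq> D" using subset_ball[of "\<delta> / 2" \<delta> x] \<delta> by auto
  ultimately show ?thesis using that[of "\<delta> / 2" "2 * 2 / (\<delta> / 2)"] \<delta>(1) by fastforce
qed

text \<open>Openness is built in by taking a union of open sets; the centre \<open>p\<close> may
  depend on \<open>V\<close> and need not be a subgradient.\<close>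

definition small_subgrad :: "real \<Rightarrow> 'a set" where
  "small_subgrad \<eta> = \<Union>{V. open V \<and> V \<subseteq> interior D \<and> (\<exists>p. \<forall>z\<in>V. \<forall>q\<in>subgrad z. norm (q - p) < \<eta>)}"

lemma open_small_subgrad: "open (small_subgrad \<eta>)"
  unfolding small_subgrad_def by (rule open_Union) blast

text \<open>A \<open>w\<^sup>*\<close>-slice in direction \<open>u\<close> of the set of subgradients near \<open>x\<close> contains, by monotonicity,
  every subgradient at points slightly moved in direction \<open>u\<close>.\<close>

lemma small_subgrad_dense:
  assumes RNP: "dual_RNP TYPE('a)" and x: "x \<in> interior D" and "e > 0" "\<eta> > 0"
  shows "\<exists>z \<in> small_subgrad \<eta>. dist z x < e"
proof -
  obtain \<delta>' L where \<delta>': "\<delta>' > 0" "ball x \<delta>' \<subseteq> D" and L': "\<And>z q. z \<in> ball x \<delta>' \<Longrightarrow> q \<in> subgrad z \<Longrightarrow> norm q \<le> L"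
    using subgrad_locally_bounded[OF x] by blast
  \<comment> \<open>The radius is cut down to \<open>e\<close> so that the point found stays that
    close to \<open>x\<close>.\<close>
  define \<delta> where "\<delta> = min \<delta>' e"
  have \<delta>: "\<delta> > 0" "ball x \<delta> \<subseteq> D" using \<delta>' \<open>e > 0\<close> by (auto simp: \<delta>_def)
  have L: "norm q \<le> L" if "z \<in> ball x \<delta>" "q \<in> subgrad z" for z q
    using that L'[of z q] by (auto simp: \<delta>_def)
  define A where "A = (\<Union>z\<in>ball x \<delta>. subgrad z)"
  have "A \<noteq> {}" using subgrad_nonempty[OF x] \<delta>(1) by (auto simp: A_def)
  moreover have "A \<subseteq> cball 0 L" using L by (auto simp: A_def)
  ultimately obtain u s p where "\<exists>q\<in>A. blinfun_apply q u > s"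
    and slice: "\<And>q. q \<in> A \<Longrightarrow> blinfun_apply q u > s \<Longrightarrow> norm (q - p) < \<eta>"
    using dual_RNP_small_slice[OF RNP] \<open>\<eta> > 0\<close> by metis
  then obtain x1 q1 where x1: "x1 \<in> ball x \<delta>" and q1: "q1 \<in> subgrad x1" "blinfun_apply q1 u > s"
    by (auto simp: A_def)
  have "L \<ge> 0" using L[OF x1 q1(1)] norm_ge_zero order_trans by blast
  have "((\<lambda>r. x1 + r *\<^sub>R u) \<longlongrightarrow> x1 + 0 *\<^sub>R u) (at_right 0)" by (intro tendsto_intros)
  then have "\<forall>\<^sub>F r in at_right 0. x1 + r *\<^sub>R u \<in> ball x \<delta>"
    using x1 by (intro topological_tendstoD) auto
  then have "\<forall>\<^sub>F r::real in at_right 0. r > 0 \<and> x1 + r *\<^sub>R u \<in> ball x \<delta>"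
    using eventually_at_right_less[of "0::real"] by (auto elim: eventually_elim2)
  then obtain r :: real where r: "r > 0" "x1 + r *\<^sub>R u \<in> ball x \<delta>"
    using eventually_happens[of _ "at_right (0::real)"] by auto
  then obtain \<rho> where \<rho>: "\<rho> > 0" "ball (x1 + r *\<^sub>R u) \<rho> \<subseteq> ball x \<delta>"
    using open_contains_ball[of "ball x \<delta>"] by blast
  \<comment> \<open>\<open>gap\<close> is the margin that \<open>q1\<close> has over the slice
    level, scaled by the step length \<open>r\<close>. The radius \<open>\<epsilon>\<close> below
    makes the error \<open>2 * L * \<epsilon>\<close> from leaving the line through
    \<open>x1\<close> smaller than this margin.\<close>
  define gap where "gap = r * (blinfun_apply q1 u - s)"
  have "gap > 0" using r q1 by (simp add: gap_def)
  define \<epsilon> where "\<epsilon> = min \<rho> (gap / (2 * L + 1))"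
  have "\<epsilon> > 0" using \<rho> \<open>gap > 0\<close> \<open>L \<ge> 0\<close> by (simp add: \<epsilon>_def)
  have "2 * L * \<epsilon> < gap"
  proof -
    have "(2 * L + 1) * \<epsilon> \<le> (2 * L + 1) * (gap / (2 * L + 1))"
      using \<open>L \<ge> 0\<close> by (intro mult_left_mono) (auto simp: \<epsilon>_def)
    also have "\<dots> = gap" using \<open>L \<ge> 0\<close> by simp
    finally show ?thesis using \<open>\<epsilon> > 0\<close> by (simp add: distrib_right)
  qed
  define V where "V = ball (x1 + r *\<^sub>R u) \<epsilon>"
  have V: "V \<subseteq> ball x \<delta>" using \<rho> by (auto simp: V_def \<epsilon>_def)
  have "norm (q - p) < \<eta>" if z: "z \<in> V" and q: "q \<in> subgrad z" for z q
  proof (rule slice)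
    have zb: "z \<in> ball x \<delta>" using z V by blast
    show "q \<in> A" using q zb by (auto simp: A_def)
    define h where "h = z - (x1 + r *\<^sub>R u)"
    have "norm h < \<epsilon>" using z by (simp add: V_def h_def dist_norm norm_minus_commute)
    have "0 \<le> blinfun_apply (q - q1) (z - x1)"
      using subgrad_monotone[OF _ _ q1(1) q] x1 zb \<delta>(2) by blast
    also have "z - x1 = r *\<^sub>R u + h" by (simp add: h_def)
    also have "blinfun_apply (q - q1) (r *\<^sub>R u + h)
        = r * (blinfun_apply q u - blinfun_apply q1 u) + blinfun_apply (q - q1) h"
      by (simp add: blinfun.diff_left blinfun.add_right blinfun.scaleR_right algebra_simps)
    also have "blinfun_apply (q - q1) h \<le> norm (q - q1) * norm h"
      using norm_blinfun[of "q - q1" h] by simp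
    also have "\<dots> \<le> (2 * L) * \<epsilon>"
      using \<open>norm h < \<epsilon>\<close> L[OF zb q] L[OF x1 q1(1)] norm_triangle_ineq4[of q q1] \<open>L \<ge> 0\<close>
      by (intro mult_mono) auto
    also have "\<dots> < gap" by fact
    finally have "0 < r * (blinfun_apply q u - blinfun_apply q1 u) + gap" by simp
    then have "0 < r * (blinfun_apply q u - s)" by (simp add: gap_def algebra_simps)
    then show "blinfun_apply q u > s" using r(1) by (simp add: zero_less_mult_iff)
  qed
  moreover have "V \<subseteq> interior D" using V \<delta>(2) by (intro interior_maximal) (auto simp: V_def)
  ultimately have "V \<subseteq> small_subgrad \<eta>" unfolding small_subgrad_def V_def by blast
  moreover have "x1 + r *\<^sub>R u \<in> V" using \<open>\<epsilon> > 0\<close> by (simp add: V_def)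
  moreover have "dist (x1 + r *\<^sub>R u) x < e" using r(2) by (simp add: \<delta>_def dist_commute)
  ultimately show ?thesis by blast
qed

text \<open>Near a point of \<open>G\<close> the subgradients cluster in norm, the usual criterion
  for Frechet differentiability of a continuous convex function.\<close>

definition G :: "'a set" where "G = (\<Inter>n::nat. small_subgrad (inverse (Suc n)))"

lemma G_subset: "G \<subseteq> interior D"
  unfolding G_def small_subgrad_def by blast

lemma G_dense:
  assumes RNP: "dual_RNP TYPE('a)" and x: "x \<in> interior D" and "e > 0"
  obtains z where "z \<in> G" "dist z x < e"
proof -
  \<comment> \<open>Baire's theorem is applied in all of \<open>X\<close>: adding the exterior of
    \<open>interior D\<close> makes each open set dense there and changes nothing inside
    \<open>interior D\<close>.\<close>
  define W where "W n = small_subgrad (inverse (Suc n)) \<union> - closure (interior D)" for n :: nat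
  have "closure (\<Inter>(range W)) = UNIV"
  proof -
    have "open (W n) \<and> closure (W n) = UNIV" for n
    proof
      show "open (W n)" unfolding W_def by (intro open_Un open_small_subgrad) auto
      have "y \<in> closure (W n)" for y
        unfolding closure_approachable
      proof (intro allI impI)
        fix c :: real assume "c > 0"
        show "\<exists>w\<in>W n. dist w y < c"
        proof (cases "y \<in> closure (interior D)")
          case True
          then obtain v where v: "v \<in> interior D" "dist v y < c / 2"
            using \<open>c > 0\<close> unfolding closure_approachable by (meson half_gt_zero)
          obtain w where "w \<in> small_subgrad (inverse (Suc n))" "dist w v < c / 2"
            using small_subgrad_dense[OF RNP v(1), of "c / 2" "inverse (Suc n)"] \<open>c > 0\<close> by auto
          then show ?thesis using v(2) dist_triangle_half_r[of v w c y] dist_triangle[of w y v]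
            by (intro bexI[of _ w]) (auto simp: W_def)
        next
          case False
          then show ?thesis using \<open>c > 0\<close> by (intro bexI[of _ y]) (auto simp: W_def)
        qed
      qed
      then show "closure (W n) = UNIV" by blast
    qed
    then have "euclidean closure_of \<Inter>(range W) = topspace (euclidean :: 'a topology)"
      by (intro Baire_category) (auto intro: completely_metrizable_space_euclidean)
    then show ?thesis by simp
  qed
  then have "interior D \<inter> ball x e \<inter> \<Inter>(range W) \<noteq> {}"
    using x \<open>e > 0\<close> open_Int_closure_eq_empty[of "interior D \<inter> ball x e" "\<Inter>(range W)"]
    by (auto simp: open_Int)
  then obtain z where z: "z \<in> interior D" "z \<in> ball x e" "\<And>n. z \<in> W n" by blast
  have "z \<in> small_subgrad (inverse (Suc n))" for n
    using z(3)[of n] z(1) closure_subset unfolding W_def by blast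
  then have "z \<in> G" by (auto simp: G_def)
  with z(2) show ?thesis using that by (simp add: dist_commute)
qed

text \<open>Smulian's argument with the exposing direction \<open>(z, - 1)\<close>: a maximizing
  sequence in the epigraph consists of approximate subgradients at \<open>z\<close>. Comparing them
  with true subgradients on a ball around \<open>z\<close>, all norm close to \<open>p\<close>,
  forces norm convergence.\<close>

lemma subgrad_G_subset_wstar_exp:
  assumes z: "z \<in> G" and p: "p \<in> subgrad z"
  shows "p \<in> wstar_exp g"
proof -
  have zD: "z \<in> D" using z G_subset interior_subset by blast
  have gp: "g p = ereal (blinfun_apply p z - F z)" by (rule subgrad_imp_g_eq[OF zD p])
  have sup: "(SUP d\<in>epi g. ereal (pair d (z, - 1))) = ereal (F z)"
  proof (rule antisym)
    show "(SUP d\<in>epi g. ereal (pair d (z, - 1))) \<le> ereal (F z)"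
      by (rule SUP_least) (use Fenchel_Young[OF zD] in \<open>auto simp: pair_def\<close>)
    have "ereal (F z) = ereal (pair (p, blinfun_apply p z - F z) (z, - 1))" by (simp add: pair_def)
    also have "\<dots> \<le> (SUP d\<in>epi g. ereal (pair d (z, - 1)))"
      using p by (intro SUP_upper) (simp add: subgrad_def)
    finally show "ereal (F z) \<le> (SUP d\<in>epi g. ereal (pair d (z, - 1)))" .
  qed
  have "c \<longlonglongrightarrow> (p, blinfun_apply p z - F z)"
    if c: "\<And>n. c n \<in> epi g" and lim: "(\<lambda>n. pair (c n) (z, - 1)) \<longlonglongrightarrow> F z" for c
  proof -
    define q where "q n = fst (c n)" for n
    define r where "r n = snd (c n)" for n
    have epi: "(q n, r n) \<in> epi g" for n using c[of n] by (simp add: q_def r_def)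
    have lim': "(\<lambda>n. blinfun_apply (q n) z - r n) \<longlonglongrightarrow> F z"
      using lim by (simp add: pair_def q_def r_def)
    have "q \<longlonglongrightarrow> p"
    proof (rule tendstoI)
      fix \<eta> :: real assume "\<eta> > 0"
      \<comment> \<open>Two distances to the common centre \<open>p'\<close>, each below
        \<open>\<eta> / 8\<close>, put the subgradients near \<open>z\<close> within
        \<open>\<eta> / 4\<close> of \<open>p\<close>.\<close>
      then obtain N :: nat where N: "inverse (real (Suc N)) < \<eta> / 8"
        using reals_Archimedean[of "\<eta> / 8"] by auto
      from z have "z \<in> small_subgrad (inverse (Suc N))" by (simp add: G_def)
      then obtain V p' where V: "open V" "V \<subseteq> interior D" "z \<in> V"
        and p': "\<And>y q. y \<in> V \<Longrightarrow> q \<in> subgrad y \<Longrightarrow> norm (q - p') < inverse (Suc N)"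
        unfolding small_subgrad_def by blast
      obtain \<delta> where \<delta>: "\<delta> > 0" "ball z \<delta> \<subseteq> V" using V open_contains_ball by blast
      have "\<forall>\<^sub>F n in sequentially. dist (blinfun_apply (q n) z - r n) (F z) < \<delta> * \<eta> / 8"
        using lim' \<delta>(1) \<open>\<eta> > 0\<close> by (intro tendstoD) auto
      then show "\<forall>\<^sub>F n in sequentially. dist (q n) p < \<eta>"
      proof eventually_elim
        case (elim n)
        \<comment> \<open>The bound adds \<open>\<eta> * \<delta> / 4\<close> from the nearby
          subgradients and \<open>\<delta> * \<eta> / 8\<close> from the approximation; the factor
          \<open>2 / \<delta>\<close> makes this three quarters of \<open>\<eta>\<close>.\<close>
        have "norm (q n - p) \<le> 2 * (3 * \<eta> * \<delta> / 8) / \<delta>"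
        proof (rule norm_blinfun_le_of_ball[OF \<delta>(1)])
          fix y assume y: "y \<in> ball z \<delta>"
          then have yV: "y \<in> V" "y \<in> interior D" using \<delta> V by auto
          then have yD: "y \<in> D" using interior_subset by blast
          obtain py where py: "py \<in> subgrad y" using subgrad_nonempty yV by blast
          have "norm (py - p) \<le> norm (py - p') + norm (p - p')"
            using norm_triangle_ineq4[of "py - p'" "p - p'"] by simp
          also have "\<dots> \<le> \<eta> / 4" using p'[OF yV(1) py] p'[OF V(3) p] N by linarith
          finally have close: "norm (py - p) \<le> \<eta> / 4" .
          have "blinfun_apply (q n) y - r n \<le> F y" by (rule Fenchel_Young[OF yD epi])
          moreover have "F z - (blinfun_apply (q n) z - r n) \<le> \<delta> * \<eta> / 8"
            using elim unfolding dist_real_def abs_less_iff by linarith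
          moreover have "blinfun_apply py (z - y) \<le> F z - F y" by (rule subgrad_le[OF yD zD py])
          ultimately have "blinfun_apply (q n - p) (y - z) \<le> blinfun_apply (py - p) (y - z) + \<delta> * \<eta> / 8"
            by (simp add: blinfun.diff_left blinfun.diff_right)
          also have "blinfun_apply (py - p) (y - z) \<le> norm (py - p) * norm (y - z)"
            using norm_blinfun[of "py - p" "y - z"] by simp
          also have "\<dots> \<le> (\<eta> / 4) * \<delta>"
            using close y \<open>\<eta> > 0\<close> by (intro mult_mono) (auto simp: dist_norm norm_minus_commute)
          finally show "blinfun_apply (q n - p) (y - z) \<le> 3 * \<eta> * \<delta> / 8" by (simp add: algebra_simps)
        qed
        also have "\<dots> = 3 / 4 * \<eta>" using \<delta>(1) by simp
        also have "\<dots> < \<eta>" using \<open>\<eta> > 0\<close> by simp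
        finally show ?case by (simp add: dist_norm)
      qed
    qed
    moreover have "(\<lambda>n. blinfun_apply (q n) z - (blinfun_apply (q n) z - r n)) \<longlonglongrightarrow> blinfun_apply p z - F z"
      by (intro tendsto_intros lim' \<open>q \<longlonglongrightarrow> p\<close>)
    then have "r \<longlonglongrightarrow> blinfun_apply p z - F z" by simp
    ultimately have "(\<lambda>n. (q n, r n)) \<longlonglongrightarrow> (p, blinfun_apply p z - F z)"
      by (rule tendsto_Pair)
    then show ?thesis by (simp add: q_def r_def)
  qed
  then have "wstar_strongly_exposed_by (epi g) (p, real_of_ereal (g p)) (z, - 1)"
    using p by (simp add: wstar_strongly_exposed_by_def sup gp subgrad_def)
  then show ?thesis using gp by (auto simp: wstar_exp_def)
qed

subsection \<open>Chains of subgradients\<close>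

text \<open>By the subgradient inequality each term is at most an increment of \<open>g\<close>
  along the chain, and the increments telescope.\<close>

lemma chain_le:
  assumes "ys 0 = p" and x: "\<And>i. i \<le> n \<Longrightarrow> x i \<in> subdiff_X g (ys i)"
  shows "ereal ((\<Sum>i<n. blinfun_apply (ys (Suc i)) (x i) - blinfun_apply (ys i) (x i))
      + (blinfun_apply h (x n) - blinfun_apply (ys n) (x n))) \<le> g h - g p"
proof -
  \<comment> \<open>The finite value of \<open>g\<close> at \<open>ys i\<close>, as a real number so
    that the sum can telescope.\<close>
  define c where "c i = blinfun_apply (ys i) (x i) - F (x i)" for i
  have gy: "g (ys i) = ereal (c i)" if "i \<le> n" for i
    unfolding c_def using x[OF that] subgrad_imp_g_eq by (simp add: mem_subdiff_X_iff)
  have step: "ereal (blinfun_apply k (x i) - blinfun_apply (ys i) (x i)) \<le> g k - ereal (c i)"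
    if "i \<le> n" for i k
    using x[OF that] gy[OF that] by (simp add: subdiff_X_def)
  have "(\<Sum>i<n. blinfun_apply (ys (Suc i)) (x i) - blinfun_apply (ys i) (x i)) \<le> (\<Sum>i<n. c (Suc i) - c i)"
  proof (rule sum_mono)
    fix i assume "i \<in> {..<n}"
    then show "blinfun_apply (ys (Suc i)) (x i) - blinfun_apply (ys i) (x i) \<le> c (Suc i) - c i"
      using step[of i "ys (Suc i)"] gy[of "Suc i"] by simp
  qed
  then have sum: "(\<Sum>i<n. blinfun_apply (ys (Suc i)) (x i) - blinfun_apply (ys i) (x i)) \<le> c n - c 0"
    by (simp add: sum_lessThan_telescope)
  show ?thesis
  proof (cases "g h")
    case (real r)
    then show ?thesis using sum step[of n h] gy[of 0] \<open>ys 0 = p\<close> by simp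
  next
    case PInf
    then show ?thesis using gy[of 0] \<open>ys 0 = p\<close> by simp
  qed (use not_MInf in blast)
qed

text \<open>Abel summation turns the chain into Bregman distances of \<open>F\<close>; a subgradient inequality at the
  reflected point \<open>2 x\<^sub>i\<^sub>+\<^sub>1 - x\<^sub>i\<close> bounds these by second differences.\<close>

lemma chain_ge:
  assumes x: "\<And>i. i \<le> n \<Longrightarrow> x i \<in> D \<and> ys i \<in> subgrad (x i)"
    and reflect: "\<And>i. i < n \<Longrightarrow> 2 *\<^sub>R x (Suc i) - x i \<in> D"
  shows "blinfun_apply h (x n) - F (x n) - (blinfun_apply (ys 0) (x 0) - F (x 0))
      - (\<Sum>i<n. F (2 *\<^sub>R x (Suc i) - x i) - 2 * F (x (Suc i)) + F (x i))
    \<le> (\<Sum>i<n. blinfun_apply (ys (Suc i)) (x i) - blinfun_apply (ys i) (x i))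
      + (blinfun_apply h (x n) - blinfun_apply (ys n) (x n))"
proof -
  define c where "c i = blinfun_apply (ys i) (x i) - F (x i)" for i
  have "(\<Sum>i<n. (c (Suc i) - c i) - (F (2 *\<^sub>R x (Suc i) - x i) - 2 * F (x (Suc i)) + F (x i)))
      \<le> (\<Sum>i<n. blinfun_apply (ys (Suc i)) (x i) - blinfun_apply (ys i) (x i))"
  proof (rule sum_mono)
    fix i assume "i \<in> {..<n}"
    then have i: "i < n" by simp
    have "blinfun_apply (ys (Suc i)) ((2 *\<^sub>R x (Suc i) - x i) - x (Suc i))
        \<le> F (2 *\<^sub>R x (Suc i) - x i) - F (x (Suc i))"
      using subgrad_le x[of "Suc i"] reflect[OF i] i by simp
    moreover have "(2 *\<^sub>R x (Suc i) - x i) - x (Suc i) = x (Suc i) - x i"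
      by (simp add: scaleR_2)
    ultimately show "(c (Suc i) - c i) - (F (2 *\<^sub>R x (Suc i) - x i) - 2 * F (x (Suc i)) + F (x i))
        \<le> blinfun_apply (ys (Suc i)) (x i) - blinfun_apply (ys i) (x i)"
      by (simp add: c_def blinfun.diff_right)
  qed
  then have "c n - c 0 - (\<Sum>i<n. F (2 *\<^sub>R x (Suc i) - x i) - 2 * F (x (Suc i)) + F (x i))
      \<le> (\<Sum>i<n. blinfun_apply (ys (Suc i)) (x i) - blinfun_apply (ys i) (x i))"
    unfolding sum_subtractf[of "\<lambda>i. c (Suc i) - c i"] sum_lessThan_telescope .
  then show ?thesis by (simp add: c_def)
qed

section \<open>Segments in the domain and their partitions\<close>

lemma segment_interior:
  assumes "x \<in> D" "y \<in> interior D" "0 < t" "t \<le> 1"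
  shows "(1 - t) *\<^sub>R x + t *\<^sub>R y \<in> interior D"
proof -
  obtain e where e: "e > 0" "ball y e \<subseteq> D" using assms(2) by (auto simp: mem_interior)
  define z where "z = (1 - t) *\<^sub>R x + t *\<^sub>R y"
  \<comment> \<open>The homothety with centre \<open>x\<close> and ratio \<open>t\<close> maps the
    ball around \<open>y\<close> onto this one.\<close>
  have "ball z (t * e) \<subseteq> D"
  proof
    fix w assume "w \<in> ball z (t * e)"
    then have "norm (w - z) < t * e" by (simp add: dist_norm norm_minus_commute)
    then have "norm ((1 / t) *\<^sub>R (w - z)) < e"
      unfolding norm_scaleR using assms(3) by (simp add: field_simps)
    then have "y + (1 / t) *\<^sub>R (w - z) \<in> D"
      using e(2) by (auto simp: dist_norm simp del: norm_scaleR)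
    then have "(1 - t) *\<^sub>R x + t *\<^sub>R (y + (1 / t) *\<^sub>R (w - z)) \<in> D"
      using convex_D assms by (intro convexD) auto
    then show "w \<in> D" using assms(3) by (simp add: scaleR_add_right z_def)
  qed
  then show ?thesis using e(1) assms(3) unfolding mem_interior z_def[symmetric]
    by (intro exI[of _ "t * e"]) simp
qed

text \<open>A near-optimal point of \<open>D\<close> is pushed slightly towards an interior point.
  Convexity alone makes the loss vanish in the limit, so no continuity of \<open>F\<close> at the
  first point is used.\<close>

lemma Fenchel_Moreau_interior:
  assumes "ereal r < g p"
  obtains u where "u \<in> interior D" "blinfun_apply p u - F u > r"
proof -
  obtain x where x: "x \<in> D" "blinfun_apply p x - F x > r" using Fenchel_Moreau[OF assms] by blast
  obtain y where y: "y \<in> interior D" using interior_D_nonempty by blast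
  then have yD: "y \<in> D" using interior_subset by blast
  have "((\<lambda>t. (1 - t) * (blinfun_apply p x - F x) + t * (blinfun_apply p y - F y))
      \<longlongrightarrow> blinfun_apply p x - F x) (at_right 0)"
    by (rule tendsto_eq_intros refl | simp)+
  then have "\<forall>\<^sub>F t in at_right 0. r < (1 - t) * (blinfun_apply p x - F x) + t * (blinfun_apply p y - F y)"
    using x(2) by (rule order_tendstoD)
  moreover have "\<forall>\<^sub>F t::real in at_right 0. 0 < t \<and> t < 1"
    unfolding eventually_at_right[OF zero_less_one] by (intro exI[of _ 1]) auto
  ultimately have "\<forall>\<^sub>F t::real in at_right 0. (0 < t \<and> t < 1) \<and>
      r < (1 - t) * (blinfun_apply p x - F x) + t * (blinfun_apply p y - F y)"
    by (auto elim: eventually_elim2)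
  then obtain t where t: "0 < t" "t < 1"
    and gt: "r < (1 - t) * (blinfun_apply p x - F x) + t * (blinfun_apply p y - F y)"
    using eventually_happens[of _ "at_right (0::real)"] by auto
  define u where "u = (1 - t) *\<^sub>R x + t *\<^sub>R y"
  have "u \<in> interior D" unfolding u_def using segment_interior x(1) y t by simp
  moreover have "F u \<le> (1 - t) * F x + t * F y"
    unfolding u_def using convex_onD[OF convex_on_F] x(1) yD t by simp
  moreover have "blinfun_apply p u = (1 - t) * blinfun_apply p x + t * blinfun_apply p y"
    by (simp only: u_def blinfun.add_right blinfun.scaleR_right real_scaleR_def)
  ultimately show ?thesis using gt that[of u] by (simp add: algebra_simps)
qed

lemma sum_second_differences:
  fixes f :: "nat \<Rightarrow> real"
  shows "(\<Sum>i<n. f (Suc (Suc i)) - 2 * f (Suc i) + f i) = (f (Suc n) - f n) - (f 1 - f 0)"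
  by (induction n) simp_all

text \<open>The second differences telescope to the last increment minus the first. Continuity of
  \<open>F\<close> at \<open>u\<close> makes the last one small, while the subgradient
  \<open>p\<close> bounds the first one from below, so \<open>x0\<close> may be a boundary
  point.\<close>

lemma segment_partition:
  assumes x0: "x0 \<in> D" "p \<in> subgrad x0" and u: "u \<in> interior D" and "\<gamma> > 0"
  obtains N :: nat and a where "a 0 = x0" "a N = u" "N > 0"
    "\<And>i. 0 < i \<Longrightarrow> i \<le> Suc N \<Longrightarrow> a i \<in> interior D"
    "\<And>i. 2 *\<^sub>R a (Suc i) - a i = a (Suc (Suc i))"
    "(\<Sum>i<N. F (2 *\<^sub>R a (Suc i) - a i) - 2 * F (a (Suc i)) + F (a i)) < \<gamma>"
proof -
  \<comment> \<open>The line is followed past \<open>u\<close>: the point at parameter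
    \<open>1 + 1/N\<close> is the reflected point of the last step.\<close>
  define A where "A t = x0 + t *\<^sub>R (u - x0)" for t :: real
  have A1: "A 1 = u" by (simp add: A_def)
  have contA: "isCont A t" for t unfolding A_def by (intro continuous_intros)
  have tA: "(\<lambda>N. A (1 + inverse (real (Suc N)))) \<longlonglongrightarrow> u"
    using isCont_tendsto_compose[OF contA[of 1], of "\<lambda>N. 1 + inverse (real (Suc N))" sequentially]
      tendsto_add[OF tendsto_const LIMSEQ_inverse_real_of_nat, of 1] by (simp add: A1)
  have "(\<lambda>N. F (A (1 + inverse (real (Suc N)))) - F u - inverse (real (Suc N)) * blinfun_apply p (u - x0))
      \<longlonglongrightarrow> F u - F u - 0 * blinfun_apply p (u - x0)"
    by (intro tendsto_intros isCont_tendsto_compose[OF isCont_F[OF u] tA] LIMSEQ_inverse_real_of_nat)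
  then have "\<forall>\<^sub>F N in sequentially.
      F (A (1 + inverse (real (Suc N)))) - F u - inverse (real (Suc N)) * blinfun_apply p (u - x0) < \<gamma>"
    using \<open>\<gamma> > 0\<close> by (intro order_tendstoD) auto
  moreover have "\<forall>\<^sub>F N in sequentially. A (1 + inverse (real (Suc N))) \<in> interior D"
    using tA u by (intro topological_tendstoD) auto
  ultimately have "\<forall>\<^sub>F N in sequentially. A (1 + inverse (real (Suc N))) \<in> interior D \<and>
      F (A (1 + inverse (real (Suc N)))) - F u - inverse (real (Suc N)) * blinfun_apply p (u - x0) < \<gamma>"
    by (rule eventually_elim2) simp
  then obtain M :: nat where M: "A (1 + inverse (real (Suc M))) \<in> interior D"
    "F (A (1 + inverse (real (Suc M)))) - F u - inverse (real (Suc M)) * blinfun_apply p (u - x0) < \<gamma>"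
    using eventually_happens[of _ sequentially] by auto
  define N where "N = Suc M"
  define a where "a i = A (real i / real N)" for i
  have "N > 0" by (simp add: N_def)
  have aN: "a 0 = x0" "a N = u" using \<open>N > 0\<close> by (simp_all add: a_def A_def)
  have aSN: "a (Suc N) = A (1 + inverse (real (Suc M)))"
  proof -
    have "real (Suc N) / real N = 1 + inverse (real (Suc M))" by (simp add: N_def field_simps)
    then show ?thesis by (simp only: a_def)
  qed
  \<comment> \<open>All these points lie on the segment from \<open>x0\<close> to the interior point
    \<open>a (Suc N)\<close>.\<close>
  have int: "a i \<in> interior D" if "0 < i" "i \<le> Suc N" for i
  proof -
    define t where "t = real i / real (Suc N)"
    have t: "0 < t" "t \<le> 1" using that by (auto simp: t_def)
    have "A (t * s) = (1 - t) *\<^sub>R x0 + t *\<^sub>R A s" for s by (simp add: A_def algebra_simps)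
    moreover have "real i / real N = t * (real (Suc N) / real N)" by (simp add: t_def)
    ultimately have "a i = (1 - t) *\<^sub>R x0 + t *\<^sub>R a (Suc N)" by (simp only: a_def)
    then show ?thesis using segment_interior[OF x0(1) _ t] M(1) aSN by simp
  qed
  have reflect: "2 *\<^sub>R a (Suc i) - a i = a (Suc (Suc i))" for i
  proof -
    have "2 *\<^sub>R A s - A t = A (2 * s - t)" for s t
      by (simp add: A_def algebra_simps scaleR_2)
    moreover have "2 * (real (Suc i) / real N) - real i / real N = real (Suc (Suc i)) / real N"
      by (simp add: diff_divide_distrib[symmetric])
    ultimately show ?thesis by (simp only: a_def)
  qed
  have "(\<Sum>i<N. F (2 *\<^sub>R a (Suc i) - a i) - 2 * F (a (Suc i)) + F (a i))
      = (F (a (Suc N)) - F u) - (F (a 1) - F x0)"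
    using sum_second_differences[of "\<lambda>i. F (a i)" N] by (simp add: reflect aN)
  moreover have "inverse (real (Suc M)) * blinfun_apply p (u - x0) \<le> F (a 1) - F x0"
  proof -
    have "a 1 \<in> D" using int[of 1] interior_subset by auto
    moreover have "a 1 - x0 = inverse (real (Suc M)) *\<^sub>R (u - x0)"
      by (simp add: a_def A_def N_def divide_inverse)
    ultimately show ?thesis using subgrad_le[OF x0(1) _ x0(2), of "a 1"] by (simp add: blinfun.scaleR_right)
  qed
  ultimately have "(\<Sum>i<N. F (2 *\<^sub>R a (Suc i) - a i) - 2 * F (a (Suc i)) + F (a i)) < \<gamma>"
    using M(2) unfolding aSN by simp
  with aN \<open>N > 0\<close> int reflect show ?thesis using that[of a N] by blast
qed

text \<open>All partition points except \<open>x0\<close> are perturbed into \<open>G\<close>, where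
  subgradients are strongly exposed points of \<open>g\<close>. The lower bound from
  \<open>chain_ge\<close> converges under the perturbation, so it stays above
  \<open>r\<close>.\<close>

lemma exists_chain:
  assumes RNP: "dual_RNP TYPE('a)" and x0: "x0 \<in> subdiff_X g p" and "ereal r < g h - g p"
  obtains n ys x where "ys 0 = p" "\<And>i. i \<in> {1..n} \<Longrightarrow> ys i \<in> wstar_exp g"
    "\<And>i. i \<le> n \<Longrightarrow> x i \<in> subdiff_X g (ys i)"
    "r < (\<Sum>i<n. blinfun_apply (ys (Suc i)) (x i) - blinfun_apply (ys i) (x i))
      + (blinfun_apply h (x n) - blinfun_apply (ys n) (x n))"
proof -
  have x0D: "x0 \<in> D" "p \<in> subgrad x0" using x0 by (simp_all add: mem_subdiff_X_iff)
  define c where "c = blinfun_apply p x0 - F x0"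
  have "g p = ereal c" unfolding c_def by (rule subgrad_imp_g_eq[OF x0D])
  then have "ereal (r + c) < g h" using assms(3) by (cases "g h") auto
  then obtain u where u: "u \<in> interior D" "blinfun_apply h u - F u > r + c"
    using Fenchel_Moreau_interior by blast
  obtain N a where a: "a 0 = x0" "a N = u" "N > 0"
    "\<And>i. 0 < i \<Longrightarrow> i \<le> Suc N \<Longrightarrow> a i \<in> interior D"
    and reflect: "\<And>i. 2 *\<^sub>R a (Suc i) - a i = a (Suc (Suc i))"
    and sum: "(\<Sum>i<N. F (2 *\<^sub>R a (Suc i) - a i) - 2 * F (a (Suc i)) + F (a i))
      < blinfun_apply h u - F u - c - r"
  proof -
    have "blinfun_apply h u - F u - c - r > 0" using u(2) by simp
    from segment_partition[OF x0D u(1) this] show ?thesis using that by blast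
  qed
  \<comment> \<open>The point with index 0 is kept fixed: \<open>F\<close> may be discontinuous at
    \<open>x0\<close>, and its functional \<open>p\<close> is prescribed.\<close>
  have "\<exists>z. (i = 0 \<longrightarrow> z = x0) \<and> (0 < i \<and> i \<le> N \<longrightarrow> z \<in> G) \<and> (i \<le> N \<longrightarrow> dist z (a i) < inverse (Suc m))"
    for i m :: nat
  proof (cases "0 < i \<and> i \<le> N")
    case True
    then have "a i \<in> interior D" using a(4) by simp
    then obtain w where "w \<in> G" "dist w (a i) < inverse (Suc m)"
      using G_dense[OF RNP, of "a i" "inverse (Suc m)"] by auto
    with True show ?thesis by (intro exI[of _ w]) simp
  next
    case False
    then show ?thesis by (intro exI[of _ x0]) (auto simp: a(1))
  qed
  then obtain z where z: "\<And>i m. (i = 0 \<longrightarrow> z i m = x0) \<and> (0 < i \<and> i \<le> N \<longrightarrow> z i m \<in> G)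
      \<and> (i \<le> N \<longrightarrow> dist (z i m) (a i) < inverse (Suc m))"
    by metis
  then have z0: "\<And>m. z 0 m = x0" and zG: "\<And>i m. 0 < i \<Longrightarrow> i \<le> N \<Longrightarrow> z i m \<in> G"
    and zd: "\<And>i m. i \<le> N \<Longrightarrow> dist (z i m) (a i) < inverse (Suc m)"
    by blast+
  have zlim: "(\<lambda>m. z i m) \<longlonglongrightarrow> a i" if "i \<le> N" for i
  proof (rule metric_tendsto_imp_tendsto[OF LIMSEQ_inverse_real_of_nat])
    show "\<forall>\<^sub>F m in sequentially. dist (z i m) (a i) \<le> dist (inverse (real (Suc m))) 0"
      using zd[OF that] by (simp add: less_imp_le)
  qed
  have Fz: "(\<lambda>m. F (z i m)) \<longlonglongrightarrow> F (a i)" if "i \<le> N" for i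
  proof (cases "i = 0")
    case True
    then show ?thesis by (simp add: z0 a(1))
  next
    case False
    then show ?thesis using isCont_tendsto_compose[OF isCont_F zlim] a(4)[of i] that by simp
  qed
  have rlim: "(\<lambda>m. 2 *\<^sub>R z (Suc i) m - z i m) \<longlonglongrightarrow> a (Suc (Suc i))" if "i < N" for i
    unfolding reflect[symmetric] using that by (intro tendsto_intros zlim) auto
  have aint: "a (Suc (Suc i)) \<in> interior D" if "i < N" for i using a(4) that by simp
  have Fr: "(\<lambda>m. F (2 *\<^sub>R z (Suc i) m - z i m)) \<longlonglongrightarrow> F (2 *\<^sub>R a (Suc i) - a i)" if "i < N" for i
    unfolding reflect by (rule isCont_tendsto_compose[OF isCont_F[OF aint[OF that]] rlim[OF that]])
  define val where "val y = blinfun_apply h (y N) - F (y N) - c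
      - (\<Sum>i<N. F (2 *\<^sub>R y (Suc i) - y i) - 2 * F (y (Suc i)) + F (y i))" for y :: "nat \<Rightarrow> 'a"
  have "(\<lambda>m. val (\<lambda>i. z i m)) \<longlonglongrightarrow> val a"
    unfolding val_def by (intro tendsto_intros zlim Fz Fr) auto
  moreover have "r < val a" using sum by (simp add: val_def a(2))
  ultimately have "\<forall>\<^sub>F m in sequentially. r < val (\<lambda>i. z i m)" by (rule order_tendstoD)
  \<comment> \<open>\<open>chain_ge\<close> also needs the reflected points in \<open>D\<close>;
    their limits are interior.\<close>
  moreover have "\<forall>\<^sub>F m in sequentially. \<forall>i\<in>{..<N}. 2 *\<^sub>R z (Suc i) m - z i m \<in> interior D"
    using topological_tendstoD[OF rlim _ aint] by (intro eventually_ball_finite) auto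
  ultimately have "\<forall>\<^sub>F m in sequentially. r < val (\<lambda>i. z i m) \<and> (\<forall>i\<in>{..<N}. 2 *\<^sub>R z (Suc i) m - z i m \<in> interior D)"
    by (rule eventually_conj)
  then obtain m where m: "r < val (\<lambda>i. z i m)" "\<And>i. i < N \<Longrightarrow> 2 *\<^sub>R z (Suc i) m - z i m \<in> interior D"
    using eventually_happens'[OF sequentially_bot] by blast
  define x where "x = (\<lambda>i. z i m)"
  \<comment> \<open>The chain must start at \<open>p\<close>, even if \<open>x0\<close> has other
    subgradients.\<close>
  have "\<exists>q. (i = 0 \<longrightarrow> q = p) \<and> (i \<le> N \<longrightarrow> q \<in> subgrad (x i))" for i
  proof (cases "0 < i \<and> i \<le> N")
    case True
    then have "x i \<in> interior D" using zG G_subset by (auto simp: x_def)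
    then show ?thesis using subgrad_nonempty True by fastforce
  next
    case False
    then show ?thesis using x0D by (intro exI[of _ p]) (auto simp: x_def z0)
  qed
  then obtain ys where ys0: "ys 0 = p" and ys: "\<And>i. i \<le> N \<Longrightarrow> ys i \<in> subgrad (x i)" by metis
  have xD: "x i \<in> D" if "i \<le> N" for i
    using x0D(1) z0 zG[of i m] that G_subset interior_subset by (cases "i = 0") (auto simp: x_def)
  have "r < val x" using m(1) by (simp add: x_def)
  also have "val x \<le> (\<Sum>i<N. blinfun_apply (ys (Suc i)) (x i) - blinfun_apply (ys i) (x i))
      + (blinfun_apply h (x N) - blinfun_apply (ys N) (x N))"
  proof -
    have "2 *\<^sub>R x (Suc i) - x i \<in> D" if "i < N" for i
      using m(2)[OF that] interior_subset unfolding x_def by blast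
    moreover have "x 0 = x0" by (simp add: x_def z0)
    ultimately show ?thesis
      using chain_ge[of N x ys h] xD ys unfolding val_def c_def ys0 by metis
  qed
  finally have "r < (\<Sum>i<N. blinfun_apply (ys (Suc i)) (x i) - blinfun_apply (ys i) (x i))
      + (blinfun_apply h (x N) - blinfun_apply (ys N) (x N))" .
  moreover have "ys i \<in> wstar_exp g" if "i \<in> {1..N}" for i
    using subgrad_G_subset_wstar_exp[OF _ ys[of i]] zG[of i m] that by (simp add: x_def)
  ultimately show ?thesis
    using that[of ys N x] ys0 ys xD by (simp add: mem_subdiff_X_iff)
qed

end

theorem mainTheorem13:
  fixes g :: "('a::banach \<Rightarrow>\<^sub>L real) \<Rightarrow> ereal"
    and x0s :: "'a \<Rightarrow>\<^sub>L real"
  assumes "dual_RNP TYPE('a)"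
    and "proper_fun g" and "convex_fun g" and "wstar_lsc g"
    and "wstar_epi_pointed g"
    and "x0s \<in> dom_subdiff_X g"
  shows "\<forall>xs. g xs - g x0s =
    Sup {ereal ((\<Sum>i<n. blinfun_apply (ys (Suc i)) (x i) - blinfun_apply (ys i) (x i))
                 + (blinfun_apply xs (x n) - blinfun_apply (ys n) (x n)))
         | n ys x. ys 0 = x0s \<and> (\<forall>i\<in>{1..n}. ys i \<in> wstar_exp g)
                   \<and> (\<forall>i\<le>n. x i \<in> subdiff_X g (ys i))}"
proof
  interpret wstar_epi_pointed_fun g by unfold_locales fact+
  obtain x0 where x0: "x0 \<in> subdiff_X g x0s" using assms(6) by (auto simp: dom_subdiff_X_def)
  fix xs
  let ?S = "{ereal ((\<Sum>i<n. blinfun_apply (ys (Suc i)) (x i) - blinfun_apply (ys i) (x i))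
                 + (blinfun_apply xs (x n) - blinfun_apply (ys n) (x n)))
         | n ys x. ys 0 = x0s \<and> (\<forall>i\<in>{1..n}. ys i \<in> wstar_exp g)
                   \<and> (\<forall>i\<le>n. x i \<in> subdiff_X g (ys i))}"
  show "g xs - g x0s = Sup ?S"
  proof (rule antisym)
    show "Sup ?S \<le> g xs - g x0s"
    proof (rule Sup_least)
      fix v assume "v \<in> ?S"
      then obtain n ys x where
        "v = ereal ((\<Sum>i<n. blinfun_apply (ys (Suc i)) (x i) - blinfun_apply (ys i) (x i))
          + (blinfun_apply xs (x n) - blinfun_apply (ys n) (x n)))"
        "ys 0 = x0s" "\<forall>i\<le>n. x i \<in> subdiff_X g (ys i)" by blast
      then show "v \<le> g xs - g x0s" using chain_le[of ys x0s n x xs] by metis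
    qed
    show "g xs - g x0s \<le> Sup ?S"
    \<comment> \<open>It suffices to compare with real upper bounds of the supremum; this also
      covers an infinite value of \<open>g xs\<close>.\<close>
    proof (rule ereal_le_real)
      fix r assume r: "Sup ?S \<le> ereal r"
      show "g xs - g x0s \<le> ereal r"
      proof (rule ccontr)
        assume "\<not> g xs - g x0s \<le> ereal r"
        then have "ereal r < g xs - g x0s" by (simp add: not_le)
        from exists_chain[OF assms(1) x0 this] obtain n ys x where
          chain: "ys 0 = x0s" "\<And>i. i \<in> {1..n} \<Longrightarrow> ys i \<in> wstar_exp g"
            "\<And>i. i \<le> n \<Longrightarrow> x i \<in> subdiff_X g (ys i)"
          and gt: "r < (\<Sum>i<n. blinfun_apply (ys (Suc i)) (x i) - blinfun_apply (ys i) (x i))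
            + (blinfun_apply xs (x n) - blinfun_apply (ys n) (x n))" by blast
        have "ereal ((\<Sum>i<n. blinfun_apply (ys (Suc i)) (x i) - blinfun_apply (ys i) (x i))
            + (blinfun_apply xs (x n) - blinfun_apply (ys n) (x n))) \<le> Sup ?S"
          by (rule Sup_upper, unfold mem_Collect_eq) (intro exI[of _ n] exI[of _ ys] exI[of _ x] conjI refl ballI allI impI chain)
        also note r
        finally show False using gt by simp
      qed
    qed
  qed
qed

end
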